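(* There is an absolute constant $C>0$ such that the following holds. For all $n, s, k \in \mathbb{N}$, all $\varepsilon > 0$ and all distributions $\mathcal{D}_0, \mathcal{D}_1$ on $\{0,1\}^n$, there exist distributions $\widetilde{\mathcal{D}}_0, \widetilde{\mathcal{D}}_1$ on $\{0,1\}^n$ such that $d_s(\mathcal{D}_b, \widetilde{\mathcal{D}}_b) \le \varepsilon$ for each $b \in \{0,1\}$ and \[ d_s(\mathcal{D}_0^{\otimes k}, \mathcal{D}_1^{\otimes k}) - k\varepsilon \le d_{\mathrm{TV}}(\widetilde{\mathcal{D}}_0^{\otimes k}, \widetilde{\mathcal{D}}_1^{\otimes k}) \le d_{s'}(\mathcal{D}_0^{\otimes k}, \mathcal{D}_1^{\otimes k}) + k\varepsilon, \] where $s' = \lceil C sk/\varepsilon^2 + (k/\varepsilon)^{C} \rceil$. Moreover, one can additionally require $\widetilde{\mathcal{D}}_0 = \mathcal{D}_0$, provided one takes $s' = \lceil C sk/\varepsilon^4 + (k/\varepsilon)^{C}\rceil$ instead.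
   Context: For distributions $P, Q$ on $\{0,1\}^m$ and $t \in \mathbb{N}$, $d_t(P,Q)$ denotes the largest distinguishing advantage $\bigl|\mathbb{E}_{z\sim P}[A(z)] - \mathbb{E}_{z \sim Q}[A(z)]\bigr|$ achievable by a Boolean circuit $A : \{0,1\}^m \to \{0,1\}$ of size at most $t$; $d_{\mathrm{TV}}$ is total variation distance; $\mathcal{D}^{\otimes k}$ is the distribution of $k$ independent samples from $\mathcal{D}$ (a distribution on $\{0,1\}^{nk}$). *)

theory Defs
  imports "HOL-Probability.Probability"
begin

definition bitstrings :: "nat \<Rightarrow> bool list set" where
  "bitstrings m = {z. length z = m}"

text \<open>
  A Boolean circuit is a sequence of NOT gates and fan-in two AND and OR gates together with an
  output wire. Each gate reads input bits, constants, or the values of strictly earlier gates, so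
  this is a directed acyclic graph with unbounded fan-out, listed in topological order. The size is
  the number of gates; input bits and constants are free.
\<close>

datatype wire = Const bool | Input nat | Gate nat

datatype gate = Not_gate wire | And_gate wire wire | Or_gate wire wire

type_synonym circuit = "gate list \<times> wire"

fun valid_wire :: "nat \<Rightarrow> nat \<Rightarrow> wire \<Rightarrow> bool" where
  "valid_wire m j (Const b) = True"
| "valid_wire m j (Input i) = (i < m)"
| "valid_wire m j (Gate i) = (i < j)"

fun valid_gate :: "nat \<Rightarrow> nat \<Rightarrow> gate \<Rightarrow> bool" where
  "valid_gate m j (Not_gate u) = valid_wire m j u"
| "valid_gate m j (And_gate u v) = (valid_wire m j u \<and> valid_wire m j v)"
| "valid_gate m j (Or_gate u v) = (valid_wire m j u \<and> valid_wire m j v)"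

fun is_circuit :: "nat \<Rightarrow> circuit \<Rightarrow> bool" where
  "is_circuit m (gs, out) =
     ((\<forall>j < length gs. valid_gate m j (gs ! j)) \<and> valid_wire m (length gs) out)"

fun circuit_size :: "circuit \<Rightarrow> nat" where
  "circuit_size (gs, out) = length gs"

text \<open>Below, \<open>z\<close> is the input string and \<open>vs\<close> lists the values of the gates evaluated so far.\<close>

fun wire_val :: "bool list \<Rightarrow> bool list \<Rightarrow> wire \<Rightarrow> bool" where
  "wire_val z vs (Const b) = b"
| "wire_val z vs (Input i) = z ! i"
| "wire_val z vs (Gate i) = vs ! i"

fun gate_val :: "bool list \<Rightarrow> bool list \<Rightarrow> gate \<Rightarrow> bool" where
  "gate_val z vs (Not_gate u) = (\<not> wire_val z vs u)"
| "gate_val z vs (And_gate u v) = (wire_val z vs u \<and> wire_val z vs v)"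
| "gate_val z vs (Or_gate u v) = (wire_val z vs u \<or> wire_val z vs v)"

fun gate_vals :: "bool list \<Rightarrow> bool list \<Rightarrow> gate list \<Rightarrow> bool list" where
  "gate_vals z vs [] = vs"
| "gate_vals z vs (g # gs) = gate_vals z (vs @ [gate_val z vs g]) gs"

fun circuit_eval :: "circuit \<Rightarrow> bool list \<Rightarrow> bool" where
  "circuit_eval (gs, out) z = wire_val z (gate_vals z [] gs) out"

definition circuits :: "nat \<Rightarrow> nat \<Rightarrow> circuit set" where
  "circuits m t = {A. is_circuit m A \<and> circuit_size A \<le> t}"

definition advantage :: "circuit \<Rightarrow> bool list pmf \<Rightarrow> bool list pmf \<Rightarrow> real" where
  "advantage A P Q =
     \<bar>measure_pmf.expectation P (\<lambda>z. of_bool (circuit_eval A z))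
      - measure_pmf.expectation Q (\<lambda>z. of_bool (circuit_eval A z))\<bar>"

text \<open>
  \<open>d_circ m t P Q\<close> is $d_t(P,Q)$ for distributions on $m$-bit strings. The supremum is a maximum,
  see \<open>d_circ_eq_Max\<close>.
\<close>

definition d_circ :: "nat \<Rightarrow> nat \<Rightarrow> bool list pmf \<Rightarrow> bool list pmf \<Rightarrow> real" where
  "d_circ m t P Q = (SUP A \<in> circuits m t. advantage A P Q)"

definition d_TV :: "'a pmf \<Rightarrow> 'a pmf \<Rightarrow> real" where
  "d_TV P Q = (SUP S. \<bar>measure_pmf.prob P S - measure_pmf.prob Q S\<bar>)"

text \<open>The \<open>k\<close> samples are concatenated, so that samples of length \<open>n\<close> give strings of length \<open>n * k\<close>.\<close>

definition k_fold :: "nat \<Rightarrow> bool list pmf \<Rightarrow> bool list pmf" where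
  "k_fold k D = map_pmf concat (replicate_pmf k D)"

lemma circuits_nonempty: "circuits m t \<noteq> {}"
proof -
  have "([], Const True) \<in> circuits m t" by (simp add: circuits_def)
  then show ?thesis by blast
qed

lemma finite_circuits: "finite (circuits m t)"
proof -
  define W where "W = range Const \<union> Input ` {..<m} \<union> Gate ` {..<t}"
  define G where "G = Not_gate ` W \<union> (\<lambda>(u, v). And_gate u v) ` (W \<times> W) \<union> (\<lambda>(u, v). Or_gate u v) ` (W \<times> W)"
  have fin: "finite W" "finite G" by (simp_all add: W_def G_def)
  have wire: "w \<in> W" if "valid_wire m j w" "j \<le> t" for j w
    using that by (cases w) (auto simp: W_def)
  have gate: "g \<in> G" if "valid_gate m j g" "j \<le> t" for j g
    using that by (cases g) (auto simp: G_def intro: wire)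
  have "set gs \<subseteq> G \<and> length gs \<le> t \<and> out \<in> W" if "(gs, out) \<in> circuits m t" for gs out
  proof -
    from that have *: "length gs \<le> t" "valid_wire m (length gs) out"
        "\<And>j. j < length gs \<Longrightarrow> valid_gate m j (gs ! j)"
      by (auto simp: circuits_def)
    have "gs ! j \<in> G" if "j < length gs" for j
      using gate[OF *(3)[OF that]] that *(1) by simp
    then show ?thesis using * wire by (auto simp: in_set_conv_nth)
  qed
  then have "circuits m t \<subseteq> {gs. set gs \<subseteq> G \<and> length gs \<le> t} \<times> W" by auto
  then show ?thesis
    using fin finite_lists_length_le[of G t] by (meson finite_SigmaI finite_subset)
qed

lemma d_circ_eq_Max: "d_circ m t P Q = Max ((\<lambda>A. advantage A P Q) ` circuits m t)"
  unfolding d_circ_def by (intro cSup_eq_Max) (simp_all add: finite_circuits circuits_nonempty)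

end

theory Submission
  imports Defs
begin

text \<open>
  Put \<open>\<mu> = D0 + D1\<close> and \<open>f = D1 / \<mu>\<close>. Starting from a constant, refine a labelling \<open>g\<close> of the
  strings by \<open>O(1/\<alpha>\<^sup>2)\<close> labels: as long as some circuit \<open>A\<close> of size \<open>s\<close> correlates by more than
  \<open>\<alpha>\<close> with the difference between \<open>f\<close> and its conditional mean given \<open>g\<close>, move this mean in the
  direction of \<open>A\<close>, round it to a grid and take the grid point as the new label. The squared error
  drops by \<open>\<alpha>\<^sup>2/4\<close> each time, so \<open>g\<close> is evaluated with \<open>4/\<alpha>\<^sup>2\<close> circuits of size \<open>s\<close> and small
  tables. Now keep the distributions of \<open>g\<close> under \<open>D0\<close> and \<open>D1\<close>, but give both the same conditional
  distribution inside every label class: that of \<open>\<mu>\<close> for the first claim, with \<open>\<alpha> = \<epsilon>/2\<close>, and that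
  of \<open>D0\<close> for the second. In the second case the error is weighted by \<open>1/(1 - v)\<close>, where \<open>v\<close> is the
  conditional mean of \<open>f\<close>; classes with \<open>1 - v < \<delta> = \<epsilon>/16\<close>, which are nearly null for \<open>D0\<close>, keep the
  conditional distribution of \<open>D1\<close>, so that \<open>\<alpha> = \<delta> * \<epsilon>\<close> suffices.

  The likelihood ratio of the new pair is a function of the label, so a nearly optimal test on \<open>k\<close>
  samples compares a sum of rounded log-likelihood ratios of labels with a threshold. Its
  advantage is the same on the original pair, and a dynamic program over the partial sums turns it
  into a circuit.
\<close>

section \<open>Circuits computing finite sets of functions\<close>

definition valid_gates :: "nat \<Rightarrow> gate list \<Rightarrow> bool" where
  "valid_gates m gs \<longleftrightarrow> (\<forall>j < length gs. valid_gate m j (gs ! j))"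

definition has_wire :: "nat \<Rightarrow> gate list \<Rightarrow> (bool list \<Rightarrow> bool) \<Rightarrow> bool" where
  "has_wire m gs f \<longleftrightarrow> (\<exists>w. valid_wire m (length gs) w \<and>
     (\<forall>z\<in>bitstrings m. wire_val z (gate_vals z [] gs) w = f z))"

text \<open>One gate list serves all functions of \<open>F\<close>, so that later gates can reuse
  them and shared work is paid for once.\<close>

definition computable :: "nat \<Rightarrow> nat \<Rightarrow> (bool list \<Rightarrow> bool) set \<Rightarrow> bool" where
  "computable m t F \<longleftrightarrow>
     (\<exists>gs. length gs \<le> t \<and> valid_gates m gs \<and> (\<forall>f\<in>F. has_wire m gs f))"

lemma gate_vals_append: "gate_vals z vs (gs @ hs) = gate_vals z (gate_vals z vs gs) hs"
  by (induction gs arbitrary: vs) auto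

lemma length_gate_vals [simp]: "length (gate_vals z vs gs) = length vs + length gs"
  by (induction gs arbitrary: vs) auto

lemma gate_vals_extends: "\<exists>us. gate_vals z vs gs = vs @ us"
  by (induction gs arbitrary: vs) (auto, metis append_assoc)

lemma wire_val_append: "valid_wire m (length vs) w \<Longrightarrow> wire_val z (vs @ us) w = wire_val z vs w"
  by (cases w) (auto simp: nth_append)

lemma valid_wire_mono: "valid_wire m j w \<Longrightarrow> j \<le> j' \<Longrightarrow> valid_wire m j' w"
  by (cases w) auto

lemma has_wire_append:
  assumes "has_wire m gs f" shows "has_wire m (gs @ hs) f"
proof -
  obtain w where w: "valid_wire m (length gs) w"
      "\<And>z. z \<in> bitstrings m \<Longrightarrow> wire_val z (gate_vals z [] gs) w = f z"
    using assms unfolding has_wire_def by blast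
  have "wire_val z (gate_vals z [] (gs @ hs)) w = f z" if z: "z \<in> bitstrings m" for z
  proof -
    obtain us where "gate_vals z (gate_vals z [] gs) hs = gate_vals z [] gs @ us"
      using gate_vals_extends by blast
    then show ?thesis
      using w z wire_val_append[of m "gate_vals z [] gs" w z us] by (simp add: gate_vals_append)
  qed
  moreover have "valid_wire m (length (gs @ hs)) w" using w(1) by (rule valid_wire_mono) simp
  ultimately show ?thesis unfolding has_wire_def by blast
qed

lemma valid_gates_append:
  assumes "valid_gates m gs" "\<And>j. j < length hs \<Longrightarrow> valid_gate m (length gs + j) (hs ! j)"
  shows "valid_gates m (gs @ hs)"
  unfolding valid_gates_def
proof (intro allI impI)
  fix j assume "j < length (gs @ hs)"
  then show "valid_gate m j ((gs @ hs) ! j)"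
    using assms(1) assms(2)[of "j - length gs"] by (auto simp: nth_append valid_gates_def)
qed

lemma computableI_append:
  assumes "length gs + length hs \<le> t" "valid_gates m gs"
    and "\<And>j. j < length hs \<Longrightarrow> valid_gate m (length gs + j) (hs ! j)"
    and "\<forall>f\<in>F. has_wire m gs f"
    and "valid_wire m (length gs + length hs) w"
      "\<And>z. z \<in> bitstrings m \<Longrightarrow> wire_val z (gate_vals z [] (gs @ hs)) w = h z"
  shows "computable m t (insert h F)"
proof -
  have "valid_gates m (gs @ hs)" using assms(2,3) by (rule valid_gates_append)
  moreover have "has_wire m (gs @ hs) h" using assms(5,6) unfolding has_wire_def by auto
  ultimately show ?thesis
    using assms(1,4) has_wire_append unfolding computable_def by (intro exI[of _ "gs @ hs"]) auto
qed

lemma computable_empty: "computable m 0 {}"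
  by (auto simp: computable_def valid_gates_def)

lemma computable_mono: "computable m t F \<Longrightarrow> t \<le> t' \<Longrightarrow> F' \<subseteq> F \<Longrightarrow> computable m t' F'"
  unfolding computable_def by (blast intro: order_trans)

lemma computable_const:
  assumes "computable m t F" shows "computable m t (insert (\<lambda>_. b) F)"
proof -
  from assms obtain gs where gs: "length gs \<le> t" "valid_gates m gs" "\<forall>f\<in>F. has_wire m gs f"
    unfolding computable_def by blast
  show ?thesis by (rule computableI_append[of gs "[]" _ _ _ "Const b"]) (use gs in auto)
qed

lemma computable_gate:
  assumes F: "computable m t F" and fg: "f \<in> F" "g \<in> F"
  shows "computable m (Suc t) (insert (\<lambda>z. \<not> f z) F)"
    and "computable m (Suc t) (insert (\<lambda>z. f z \<and> g z) F)"
    and "computable m (Suc t) (insert (\<lambda>z. f z \<or> g z) F)"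
proof -
  from F obtain gs where gs: "length gs \<le> t" "valid_gates m gs" "\<forall>f\<in>F. has_wire m gs f"
    unfolding computable_def by blast
  obtain u where u: "valid_wire m (length gs) u"
      "\<And>z. z \<in> bitstrings m \<Longrightarrow> wire_val z (gate_vals z [] gs) u = f z"
    using bspec[OF gs(3) fg(1)] unfolding has_wire_def by metis
  obtain v where v: "valid_wire m (length gs) v"
      "\<And>z. z \<in> bitstrings m \<Longrightarrow> wire_val z (gate_vals z [] gs) v = g z"
    using bspec[OF gs(3) fg(2)] unfolding has_wire_def by metis
  let ?w = "Gate (length gs)"
  show "computable m (Suc t) (insert (\<lambda>z. \<not> f z) F)"
    by (rule computableI_append[of gs "[Not_gate u]" _ _ _ ?w])
      (use gs u v in \<open>auto simp: gate_vals_append nth_append\<close>)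
  show "computable m (Suc t) (insert (\<lambda>z. f z \<and> g z) F)"
    by (rule computableI_append[of gs "[And_gate u v]" _ _ _ ?w])
      (use gs u v in \<open>auto simp: gate_vals_append nth_append\<close>)
  show "computable m (Suc t) (insert (\<lambda>z. f z \<or> g z) F)"
    by (rule computableI_append[of gs "[Or_gate u v]" _ _ _ ?w])
      (use gs u v in \<open>auto simp: gate_vals_append nth_append\<close>)
qed

lemma computable_circuit_exists:
  assumes "computable m t F" "f \<in> F"
  obtains A where "A \<in> circuits m t" "\<And>z. z \<in> bitstrings m \<Longrightarrow> circuit_eval A z = f z"
proof -
  from assms obtain gs w where "length gs \<le> t" "valid_gates m gs"
    "valid_wire m (length gs) w"
    "\<forall>z\<in>bitstrings m. wire_val z (gate_vals z [] gs) w = f z"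
    unfolding computable_def has_wire_def by blast
  then show ?thesis by (intro that[of "(gs, w)"]) (auto simp: circuits_def valid_gates_def)
qed

section \<open>Feeding inputs and constants into a circuit\<close>

fun subst_wire :: "(nat \<Rightarrow> wire) \<Rightarrow> nat \<Rightarrow> wire \<Rightarrow> wire" where
  "subst_wire \<sigma> r (Const b) = Const b"
| "subst_wire \<sigma> r (Input i) = \<sigma> i"
| "subst_wire \<sigma> r (Gate i) = Gate (r + i)"

fun subst_gate :: "(nat \<Rightarrow> wire) \<Rightarrow> nat \<Rightarrow> gate \<Rightarrow> gate" where
  "subst_gate \<sigma> r (Not_gate u) = Not_gate (subst_wire \<sigma> r u)"
| "subst_gate \<sigma> r (And_gate u v) = And_gate (subst_wire \<sigma> r u) (subst_wire \<sigma> r v)"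
| "subst_gate \<sigma> r (Or_gate u v) = Or_gate (subst_wire \<sigma> r u) (subst_wire \<sigma> r v)"

text \<open>\<open>valid_wire m 0\<close> leaves only inputs and constants for
  \<open>\<sigma> i\<close>, so substituted wires do not depend on gates; gate indices are shifted
  by \<open>r\<close>, the number of gates already present.\<close>

lemma valid_subst_wire:
  assumes "\<And>i. i < n \<Longrightarrow> valid_wire m 0 (\<sigma> i)" "valid_wire n j w"
  shows "valid_wire m (r + j) (subst_wire \<sigma> r w)"
  using assms(2) valid_wire_mono[OF assms(1)] by (cases w) auto

lemma valid_subst_gate:
  assumes "\<And>i. i < n \<Longrightarrow> valid_wire m 0 (\<sigma> i)" "valid_gate n j g"
  shows "valid_gate m (r + j) (subst_gate \<sigma> r g)"
  using assms(2) valid_subst_wire[OF assms(1)] by (cases g) auto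

lemma wire_val_subst:
  assumes "\<And>i. i < n \<Longrightarrow> valid_wire m 0 (\<sigma> i)" "\<And>i. i < n \<Longrightarrow> wire_val z [] (\<sigma> i) = z' ! i"
    and "valid_wire n (length vs) w"
  shows "wire_val z (us @ vs) (subst_wire \<sigma> (length us) w) = wire_val z' vs w"
proof (cases w)
  case (Input i)
  then show ?thesis using assms wire_val_append[of m "[]" "\<sigma> i" z "us @ vs"] by auto
qed auto

lemma gate_vals_subst:
  assumes \<sigma>: "\<And>i. i < n \<Longrightarrow> valid_wire m 0 (\<sigma> i)" "\<And>i. i < n \<Longrightarrow> wire_val z [] (\<sigma> i) = z' ! i"
    and "\<And>j. j < length gs \<Longrightarrow> valid_gate n (length vs + j) (gs ! j)"
  shows "gate_vals z (us @ vs) (map (subst_gate \<sigma> (length us)) gs) = us @ gate_vals z' vs gs"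
  using assms(3)
proof (induction gs arbitrary: vs)
  case (Cons g gs)
  have "valid_gate n (length vs) g" using Cons.prems[of 0] by simp
  then have "gate_val z (us @ vs) (subst_gate \<sigma> (length us) g) = gate_val z' vs g"
    by (cases g) (auto simp: wire_val_subst[OF \<sigma>])
  moreover have "\<And>j. j < length gs \<Longrightarrow> valid_gate n (length (vs @ [gate_val z' vs g]) + j) (gs ! j)"
    using Cons.prems[of "Suc j" for j] by auto
  ultimately show ?case using Cons.IH[of "vs @ [gate_val z' vs g]"] by simp
qed simp

text \<open>Used twice: to read one block of a longer string, and to fix all samples but one as
  constants.\<close>

lemma computable_subst_circuit:
  assumes F: "computable m t F" and A: "A \<in> circuits n s"
    and \<sigma>: "\<And>i. i < n \<Longrightarrow> valid_wire m 0 (\<sigma> i)"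
  shows "computable m (t + s) (insert (\<lambda>z. circuit_eval A (map (\<lambda>i. wire_val z [] (\<sigma> i)) [0..<n])) F)"
proof -
  from F obtain gs where gs: "length gs \<le> t" "valid_gates m gs" "\<forall>f\<in>F. has_wire m gs f"
    unfolding computable_def by blast
  obtain hs out where A_eq: "A = (hs, out)" by fastforce
  with A have hs: "length hs \<le> s" "\<And>j. j < length hs \<Longrightarrow> valid_gate n j (hs ! j)"
    "valid_wire n (length hs) out"
    by (auto simp: circuits_def)
  let ?hs = "map (subst_gate \<sigma> (length gs)) hs"
  show ?thesis
  proof (rule computableI_append[of gs ?hs _ _ _ "subst_wire \<sigma> (length gs) out"])
    fix z assume "z \<in> bitstrings m"
    let ?z' = "map (\<lambda>i. wire_val z [] (\<sigma> i)) [0..<n]"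
    let ?us = "gate_vals z [] gs"
    have len: "length gs = length ?us" by simp
    have "gate_vals z ?us ?hs = ?us @ gate_vals ?z' [] hs"
      using gate_vals_subst[of n m \<sigma> z ?z' hs "[]" ?us] \<sigma> hs(2) by simp
    moreover have "wire_val z (?us @ gate_vals ?z' [] hs) (subst_wire \<sigma> (length ?us) out) =
        wire_val ?z' (gate_vals ?z' [] hs) out"
      by (rule wire_val_subst[of n m]) (use \<sigma> hs in auto)
    ultimately show "wire_val z (gate_vals z [] (gs @ ?hs)) (subst_wire \<sigma> (length gs) out)
        = circuit_eval A ?z'"
      by (simp add: gate_vals_append A_eq)
  qed (use gs hs valid_subst_gate[of n m \<sigma>, OF \<sigma>] valid_subst_wire[of n m \<sigma>, OF \<sigma>] in auto)
qed

section \<open>Disjunctions, tables and the dynamic program\<close>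

lemma computable_disj:
  assumes "finite I" "computable m t F" "\<And>i. i \<in> I \<Longrightarrow> f i \<in> F"
  shows "computable m (t + card I) (insert (\<lambda>z. \<exists>i\<in>I. f i z) F)"
proof -
  have "computable m (t + card J) (insert (\<lambda>z. \<exists>i\<in>J. f i z) F)" if "J \<subseteq> I" for J
    using finite_subset[OF that assms(1)] that
  proof (induction J rule: finite_induct)
    case empty
    show ?case using computable_const[OF assms(2), of False] by simp
  next
    case (insert a J)
    let ?G = "insert (\<lambda>z. \<exists>i\<in>J. f i z) F"
    have "computable m (t + card J) ?G" "f a \<in> ?G"
      using insert.IH insert.prems assms(3) by auto
    from computable_gate(3)[OF this(1,2), of "\<lambda>z. \<exists>i\<in>J. f i z"]
    have "computable m (Suc (t + card J)) (insert (\<lambda>z. f a z \<or> (\<exists>i\<in>J. f i z)) ?G)"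
      by simp
    then show ?case
      by (rule computable_mono) (simp_all add: insert.hyps subset_insertI2 subset_insertI)
  qed
  then show ?thesis by simp
qed

lemma computable_family:
  assumes "finite J" "computable m t F"
    and "\<And>t F' j. F \<subseteq> F' \<Longrightarrow> computable m t F' \<Longrightarrow> j \<in> J \<Longrightarrow> computable m (t + a) (insert (h j) F')"
  shows "computable m (t + card J * a) (h ` J \<union> F)"
proof -
  have "computable m (t + card J' * a) (h ` J' \<union> F)" if "J' \<subseteq> J" for J'
    using finite_subset[OF that assms(1)] that
  proof (induction J' rule: finite_induct)
    case empty
    show ?case using assms(2) by simp
  next
    case (insert x J')
    then have "computable m (t + card J' * a + a) (insert (h x) (h ` J' \<union> F))"
      by (intro assms(3)) auto
    then show ?case using insert.hyps by (simp add: algebra_simps)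
  qed
  then show ?thesis by simp
qed

text \<open>One-hot encoding: a function with values below \<open>N\<close> is carried by
  \<open>N\<close> Boolean wires.\<close>

definition indicators :: "nat \<Rightarrow> (bool list \<Rightarrow> nat) \<Rightarrow> (bool list \<Rightarrow> bool) set" where
  "indicators N u = (\<lambda>i z. u z = i) ` {..<N}"

text \<open>One conjunction for each of the \<open>N * M\<close> value pairs, then for each of the
  \<open>K\<close> outputs a disjunction over the pairs that \<open>\<tau>\<close> sends there. The
  bound is the same for every table \<open>\<tau>\<close>.\<close>

lemma computable_combine:
  assumes F: "computable m t F" and u: "indicators N u \<subseteq> F" and v: "indicators M v \<subseteq> F"
    and lt: "\<And>z. u z < N" "\<And>z. v z < M"
  shows "computable m (t + N * M + K * (N * M)) (indicators K (\<lambda>z. \<tau> (u z) (v z)) \<union> F)"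
proof -
  define h where "h = (\<lambda>(i, j) z. u z = i \<and> v z = (j::nat))"
  let ?I = "{..<N} \<times> {..<M}"
  have "computable m (t + card ?I * 1) (h ` ?I \<union> F)"
  proof (rule computable_family)
    fix t F' p assume F': "F \<subseteq> F'" "computable m t F'" "p \<in> ?I"
    obtain i j where p: "p = (i, j)" "i < N" "j < M" using F'(3) by auto
    have "(\<lambda>z. u z = i) \<in> F'" "(\<lambda>z. v z = j) \<in> F'"
      using u v F'(1) p by (auto simp: indicators_def image_subset_iff)
    from computable_gate(2)[OF F'(2) this]
    show "computable m (t + 1) (insert (h p) F')" by (simp add: h_def p)
  qed (use F in auto)
  then have 1: "computable m (t + N * M) (h ` ?I \<union> F)" by simp
  have "computable m (t + N * M + card {..<K} * (N * M))
      ((\<lambda>l z. \<tau> (u z) (v z) = l) ` {..<K} \<union> (h ` ?I \<union> F))"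
  proof (rule computable_family[OF _ 1])
    fix t F' l assume F': "h ` ?I \<union> F \<subseteq> F'" "computable m t F'"
    let ?J = "{(i, j). (i, j) \<in> ?I \<and> \<tau> i j = l}"
    have sub: "?J \<subseteq> ?I" by auto
    then have fin: "finite ?J" by (rule finite_subset) simp
    have "computable m (t + card ?J) (insert (\<lambda>z. \<exists>p\<in>?J. h p z) F')"
      using F' by (intro computable_disj fin) auto
    moreover have "card ?J \<le> N * M" using card_mono[OF _ sub] by simp
    moreover have "(\<lambda>z. \<exists>p\<in>?J. h p z) = (\<lambda>z. \<tau> (u z) (v z) = l)"
      using lt by (auto simp: h_def fun_eq_iff)
    ultimately show "computable m (t + N * M) (insert (\<lambda>z. \<tau> (u z) (v z) = l) F')"
      by (elim computable_mono) auto
  qed simp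
  then show ?thesis by (rule computable_mono) (auto simp: indicators_def)
qed

text \<open>Such a \<open>g\<close> is a program with \<open>L\<close> memory states: it queries
  \<open>T\<close> circuits of size \<open>s\<close> one after the other, and a table computes the
  next label from the old one and the answer. As the labels stay below \<open>L\<close>, the cost
  grows linearly in \<open>T\<close>, not exponentially.\<close>

inductive labelling :: "nat \<Rightarrow> nat \<Rightarrow> nat \<Rightarrow> nat \<Rightarrow> (bool list \<Rightarrow> nat) \<Rightarrow> bool"
  for n s L :: nat where
  start: "labelling n s L 0 (\<lambda>_. 0)"
| step: "labelling n s L T g \<Longrightarrow> A \<in> circuits n s \<Longrightarrow> (\<And>l b. \<tau> l b < L) \<Longrightarrow>
     labelling n s L (Suc T) (\<lambda>x. \<tau> (g x) (circuit_eval A x))"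

lemma labelling_less: "labelling n s L T g \<Longrightarrow> L > 0 \<Longrightarrow> g x < L"
  by (induction rule: labelling.induct) auto

definition block :: "nat \<Rightarrow> nat \<Rightarrow> bool list \<Rightarrow> bool list" where
  "block n j z = map (\<lambda>i. z ! (n * j + i)) [0..<n]"

lemma computable_labelling:
  assumes "labelling n s L T g" "L > 0" "n * Suc j \<le> m" "computable m t F"
  shows "computable m (t + T * (s + 1 + 2 * L + 2 * L\<^sup>2)) (indicators L (\<lambda>z. g (block n j z)) \<union> F)"
  using assms(1)
proof (induction rule: labelling.induct)
  case start
  have "computable m t (insert (\<lambda>_. True) (insert (\<lambda>_. False) F))"
    by (intro computable_const assms)
  then show ?case by (rule computable_mono) (auto simp: indicators_def)
next
  case (step T g A \<tau>)
  \<comment> \<open>Per round: \<open>s\<close> gates for \<open>A\<close>, one for its negation,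
    and the table for \<open>L\<close> labels and two answers.\<close>
  let ?c = "s + 1 + 2 * L + 2 * L\<^sup>2"
  let ?a = "\<lambda>z. circuit_eval A (block n j z)"
  let ?F = "indicators L (\<lambda>z. g (block n j z)) \<union> F"
  let ?G = "insert (\<lambda>z. \<not> ?a z) (insert ?a ?F)"
  have "n * j + i < m" if "i < n" for i using assms(3) that by simp
  then have "computable m (t + T * ?c + s) (insert ?a ?F)"
    using computable_subst_circuit[OF step.IH step.hyps(2), of "\<lambda>i. Input (n * j + i)"]
    by (simp add: block_def)
  from computable_gate(1)[OF this, of ?a ?a]
  have G: "computable m (Suc (t + T * ?c + s)) ?G" by simp
  \<comment> \<open>The answer and its negation together are its one-hot encoding.\<close>
  have "(\<lambda>z. of_bool (?a z) = (0::nat)) = (\<lambda>z. \<not> ?a z)" "(\<lambda>z. of_bool (?a z) = Suc 0) = ?a"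
    by (auto simp: fun_eq_iff)
  then have ind: "indicators 2 (\<lambda>z. of_bool (?a z)) \<subseteq> ?G"
    by (auto simp: indicators_def lessThan_nat_numeral lessThan_Suc)
  have "computable m (Suc (t + T * ?c + s) + L * 2 + L * (L * 2))
     (indicators L (\<lambda>z. \<tau> (g (block n j z)) (of_bool (?a z) = (1::nat))) \<union> ?G)"
    by (rule computable_combine[OF G _ ind, where \<tau> = "\<lambda>l b. \<tau> l (b = 1)"])
      (use labelling_less[OF step.hyps(1) assms(2)] in auto)
  then show ?case
    unfolding of_bool_eq_1_iff
    by (rule computable_mono) (auto simp: algebra_simps power2_eq_square)
qed

text \<open>Dynamic program: the one-hot encoded partial sum is combined with the label of the next
  block. The cap at \<open>k * W\<close> bounds the state for all \<open>z\<close> at once, and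
  capping before an addition does not change the capped result.\<close>

lemma computable_weighted_sum:
  assumes lab: "labelling n s L T g" "L > 0" and w: "\<And>l. w l \<le> W" and "N = k * W + 1"
    and "j \<le> k"
  shows "computable (n * k) (j * (T * (s + 1 + 2 * L + 2 * L\<^sup>2) + N * L + N * (N * L)))
     (indicators N (\<lambda>z. min (k * W) (\<Sum>i<j. w (g (block n i z)))))"
  using \<open>j \<le> k\<close>
proof (induction j)
  case 0
  have "computable (n * k) 0 (insert (\<lambda>_. True) (insert (\<lambda>_. False) {}))"
    by (intro computable_const computable_empty)
  then show ?case by (rule computable_mono) (auto simp: indicators_def)
next
  case (Suc j)
  let ?c = "T * (s + 1 + 2 * L + 2 * L\<^sup>2) + N * L + N * (N * L)"
  let ?u = "\<lambda>j z. min (k * W) (\<Sum>i<j. w (g (block n i z)))"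
  let ?v = "\<lambda>z. g (block n j z)"
  have "n * Suc j \<le> n * k" using Suc.prems by (intro mult_left_mono) auto
  from computable_labelling[OF lab this, of "j * ?c" "indicators N (?u j)"] Suc
  have 1: "computable (n * k) (j * ?c + T * (s + 1 + 2 * L + 2 * L\<^sup>2))
      (indicators L ?v \<union> indicators N (?u j))" by simp
  have "computable (n * k) (j * ?c + T * (s + 1 + 2 * L + 2 * L\<^sup>2) + N * L + N * (N * L))
      (indicators N (\<lambda>z. min (k * W) (?u j z + w (?v z))) \<union> (indicators L ?v \<union> indicators N (?u j)))"
    by (rule computable_combine[OF 1, where \<tau> = "\<lambda>a l. min (k * W) (a + w l)"])
      (use labelling_less[OF lab] assms(4) in auto)
  moreover have "(\<lambda>z. min (k * W) (?u j z + w (?v z))) = ?u (Suc j)"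
    by (auto simp: fun_eq_iff)
  ultimately show ?case by (elim computable_mono) auto
qed

text \<open>The sum over all \<open>k\<close> blocks is at most \<open>k * W\<close>, so the cap
  disappears; the threshold is one more disjunction over at most \<open>N\<close> values.\<close>

lemma threshold_circuit_exists:
  assumes lab: "labelling n s L T g" "L > 0" and w: "\<And>l. w l \<le> W" and N: "N = k * W + 1"
  obtains A where
    "A \<in> circuits (n * k) (k * (T * (s + 1 + 2 * L + 2 * L\<^sup>2) + N * L + N * (N * L)) + N)"
    "\<And>z. z \<in> bitstrings (n * k) \<Longrightarrow>
       circuit_eval A z \<longleftrightarrow> \<theta> \<le> (\<Sum>i<k. w (g (block n i z)))"
proof -
  let ?u = "\<lambda>z. \<Sum>i<k. w (g (block n i z))"
  let ?t = "k * (T * (s + 1 + 2 * L + 2 * L\<^sup>2) + N * L + N * (N * L))"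
  have le: "?u z \<le> k * W" for z
    using sum_bounded_above[of "{..<k}" "\<lambda>i. w (g (block n i z))" W] w by simp
  then have "computable (n * k) ?t (indicators N ?u)"
    using computable_weighted_sum[where w = w, OF lab w N order_refl] by (simp add: min_absorb2)
  from computable_disj[OF _ this, of "{\<theta>..<N}" "\<lambda>i z. ?u z = i"]
  have "computable (n * k) (?t + (N - \<theta>)) (insert (\<lambda>z. \<exists>i\<in>{\<theta>..<N}. ?u z = i) (indicators N ?u))"
    by (auto simp: indicators_def)
  moreover have "(\<lambda>z. \<exists>i\<in>{\<theta>..<N}. ?u z = i) = (\<lambda>z. \<theta> \<le> ?u z)"
    using le N by (auto simp: fun_eq_iff less_Suc_eq_le)
  ultimately have "computable (n * k) (?t + N) {\<lambda>z. \<theta> \<le> ?u z}"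
    by (elim computable_mono) auto
  then show ?thesis by (rule computable_circuit_exists[of _ _ _ "\<lambda>z. \<theta> \<le> ?u z"]) (use that in auto)
qed

section \<open>Finitely supported distributions and hybrids\<close>

lemma expectation_finite_support:
  fixes f :: "'a \<Rightarrow> real"
  assumes "finite X" "set_pmf D \<subseteq> X"
  shows "measure_pmf.expectation D f = (\<Sum>x\<in>X. pmf D x * f x)"
  using assms by (subst integral_measure_pmf_real[of X]) (auto simp: mult.commute)

lemma prob_finite_support:
  assumes "finite X" "set_pmf D \<subseteq> X"
  shows "measure_pmf.prob D S = (\<Sum>x\<in>X. pmf D x * indicator S x)"
  using expectation_finite_support[OF assms, of "indicator S"] by simp

lemma sum_pmf_finite_support: "finite X \<Longrightarrow> set_pmf D \<subseteq> X \<Longrightarrow> (\<Sum>x\<in>X. pmf D x) = 1"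
  using prob_finite_support[of X D UNIV] by simp

lemma finite_set_replicate_pmf: "finite (set_pmf P) \<Longrightarrow> finite (set_pmf (replicate_pmf k P))"
  using finite_lists_length_eq[of "set_pmf P" k]
  by (simp add: set_replicate_pmf in_lists_conv_set subset_eq)

lemma expectation_replicate_Suc:
  fixes F :: "'a list \<Rightarrow> real"
  assumes "finite X" "set_pmf P \<subseteq> X"
  shows "measure_pmf.expectation (replicate_pmf (Suc k) P) F =
    (\<Sum>x\<in>X. pmf P x * measure_pmf.expectation (replicate_pmf k P) (\<lambda>xs. F (x # xs)))"
proof -
  have fin: "finite (set_pmf P)" using assms finite_subset by blast
  show ?thesis
    by (simp, subst pmf_expectation_bind[OF assms(1) _ assms(2)])
      (auto simp: finite_set_replicate_pmf fin map_pmf_def[symmetric])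
qed

text \<open>Hybrid argument, exchanging one coordinate at a time. It is stated for a fixed
  \<open>F\<close> with the other coordinates frozen, so that it applies both to circuits with
  hardwired samples and to arbitrary events.\<close>

lemma replicate_pmf_hybrid:
  fixes F :: "'a list \<Rightarrow> real"
  assumes X: "finite X" "set_pmf P \<subseteq> X" "set_pmf Q \<subseteq> X"
    and bound: "\<And>us vs. set us \<subseteq> X \<Longrightarrow> set vs \<subseteq> X \<Longrightarrow> length us + length vs + 1 = k \<Longrightarrow>
      \<bar>measure_pmf.expectation P (\<lambda>x. F (us @ x # vs)) -
       measure_pmf.expectation Q (\<lambda>x. F (us @ x # vs))\<bar> \<le> \<beta>"
  shows "\<bar>measure_pmf.expectation (replicate_pmf k P) F -
     measure_pmf.expectation (replicate_pmf k Q) F\<bar> \<le> real k * \<beta>"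
  using bound
proof (induction k arbitrary: F)
  case 0
  then show ?case by simp
next
  case (Suc k)
  let ?E = "\<lambda>D. measure_pmf.expectation D"
  \<comment> \<open>\<open>a x\<close> and \<open>b x\<close> are the means of \<open>F\<close> with
    first entry \<open>x\<close> and tail drawn from \<open>P\<close> and from \<open>Q\<close>. The
    total difference splits into \<open>P (a - b)\<close>, bounded by the induction hypothesis, and
    \<open>(P - Q) b\<close>, where only the head changes.\<close>
  define a where "a x = ?E (replicate_pmf k P) (\<lambda>xs. F (x # xs))" for x
  define b where "b x = ?E (replicate_pmf k Q) (\<lambda>xs. F (x # xs))" for x
  define U where "U = {xs. set xs \<subseteq> X \<and> length xs = k}"
  have U: "finite U" "set_pmf (replicate_pmf k Q) \<subseteq> U"
    using X finite_lists_length_eq[of X k] by (auto simp: U_def set_replicate_pmf)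
  have ab: "\<bar>a x - b x\<bar> \<le> real k * \<beta>" if "x \<in> X" for x
    unfolding a_def b_def
  proof (rule Suc.IH)
    fix us vs assume "set us \<subseteq> X" "set vs \<subseteq> X" "length us + length vs + 1 = k"
    with Suc.prems[of "x # us" vs] that
    show "\<bar>?E P (\<lambda>y. F (x # us @ y # vs)) - ?E Q (\<lambda>y. F (x # us @ y # vs))\<bar> \<le> \<beta>"
      by simp
  qed
  have 1: "\<bar>\<Sum>x\<in>X. pmf P x * (a x - b x)\<bar> \<le> real k * \<beta>"
  proof -
    have "\<bar>\<Sum>x\<in>X. pmf P x * (a x - b x)\<bar> \<le> (\<Sum>x\<in>X. pmf P x * (real k * \<beta>))"
      by (intro order.trans[OF sum_abs] sum_mono) (simp add: abs_mult ab mult_left_mono)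
    then show ?thesis
      using sum_pmf_finite_support[OF X(1,2)] by (simp flip: sum_distrib_right)
  qed
  \<comment> \<open>Exchanging the sums freezes the tail, so that the assumed bound applies with
    \<open>us = []\<close>.\<close>
  have "(\<Sum>x\<in>X. (pmf P x - pmf Q x) * b x) =
      (\<Sum>x\<in>X. \<Sum>xs\<in>U. (pmf P x - pmf Q x) * (pmf (replicate_pmf k Q) xs * F (x # xs)))"
    unfolding b_def by (simp add: expectation_finite_support[OF U] sum_distrib_left)
  also have "\<dots> = (\<Sum>xs\<in>U. \<Sum>x\<in>X. (pmf P x - pmf Q x) * (pmf (replicate_pmf k Q) xs * F (x # xs)))"
    by (rule sum.swap)
  also have "\<dots> = (\<Sum>xs\<in>U. pmf (replicate_pmf k Q) xs *
      (?E P (\<lambda>x. F (x # xs)) - ?E Q (\<lambda>x. F (x # xs))))"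
    by (simp add: expectation_finite_support[OF X(1,2)] expectation_finite_support[OF X(1,3)]
        sum_distrib_left sum_subtractf algebra_simps)
  finally have eq: "(\<Sum>x\<in>X. (pmf P x - pmf Q x) * b x) = \<dots>" .
  have 2: "\<bar>\<Sum>x\<in>X. (pmf P x - pmf Q x) * b x\<bar> \<le> \<beta>"
  proof -
    have *: "\<bar>?E P (\<lambda>x. F (x # xs)) - ?E Q (\<lambda>x. F (x # xs))\<bar> \<le> \<beta>" if "xs \<in> U" for xs
      using Suc.prems[of "[]" xs] that by (simp add: U_def)
    have "\<bar>\<Sum>x\<in>X. (pmf P x - pmf Q x) * b x\<bar> \<le> (\<Sum>xs\<in>U. pmf (replicate_pmf k Q) xs * \<beta>)"
      unfolding eq
      by (intro order.trans[OF sum_abs] sum_mono) (simp add: abs_mult * mult_left_mono)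
    then show ?thesis
      using sum_pmf_finite_support[OF U] by (simp flip: sum_distrib_right)
  qed
  have "?E (replicate_pmf (Suc k) P) F - ?E (replicate_pmf (Suc k) Q) F =
      (\<Sum>x\<in>X. pmf P x * (a x - b x)) + (\<Sum>x\<in>X. (pmf P x - pmf Q x) * b x)"
    unfolding expectation_replicate_Suc[OF X(1,2)] expectation_replicate_Suc[OF X(1,3)]
    by (simp add: a_def b_def sum.distrib sum_subtractf algebra_simps)
  with 1 2 show ?case by (simp add: algebra_simps)
qed

lemma prob_replicate_pmf_hybrid:
  assumes X: "finite X" "set_pmf P \<subseteq> X" "set_pmf Q \<subseteq> X"
    and bound: "\<And>S. \<bar>measure_pmf.prob P S - measure_pmf.prob Q S\<bar> \<le> \<beta>"
  shows "\<bar>measure_pmf.prob (replicate_pmf k P) S - measure_pmf.prob (replicate_pmf k Q) S\<bar> \<le> real k * \<beta>"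
proof -
  have "\<bar>measure_pmf.expectation P (\<lambda>x. indicator S (us @ x # vs)) -
       measure_pmf.expectation Q (\<lambda>x. indicator S (us @ x # vs))\<bar> \<le> \<beta>" for us vs
  proof -
    have "(\<lambda>x. indicator S (us @ x # vs) :: real) = indicator {x. us @ x # vs \<in> S}"
      by (auto simp: indicator_def)
    then show ?thesis using bound[of "{x. us @ x # vs \<in> S}"] by simp
  qed
  then show ?thesis
    using replicate_pmf_hybrid[OF X, where F = "indicator S" and k = k and \<beta> = \<beta>] by simp
qed

section \<open>Total variation and circuit distance\<close>

lemma d_TV_upper:
  "\<bar>measure_pmf.prob P S - measure_pmf.prob Q S\<bar> \<le> d_TV P Q"
proof -
  have "\<bar>measure_pmf.prob P S - measure_pmf.prob Q S\<bar> \<le> 1" for S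
    using measure_pmf.prob_le_1[of P S] measure_pmf.prob_le_1[of Q S]
      measure_nonneg[of "measure_pmf P" S] measure_nonneg[of "measure_pmf Q" S] by linarith
  then show ?thesis unfolding d_TV_def by (intro cSUP_upper bdd_aboveI[of _ 1]) auto
qed

text \<open>One sign suffices, since passing to the complement of an event flips the sign of the
  difference.\<close>

lemma d_TV_leI:
  "(\<And>S. measure_pmf.prob Q S - measure_pmf.prob P S \<le> c) \<Longrightarrow> d_TV P Q \<le> c"
  unfolding d_TV_def
proof (rule cSUP_least)
  fix S assume *: "\<And>S. measure_pmf.prob Q S - measure_pmf.prob P S \<le> c"
  show "\<bar>measure_pmf.prob P S - measure_pmf.prob Q S\<bar> \<le> c"
    using *[of S] *[of "- S"] measure_pmf.prob_compl[of S P] measure_pmf.prob_compl[of S Q]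
    by (simp add: Compl_eq_Diff_UNIV)
qed simp

lemma d_TV_le_1: "d_TV P Q \<le> 1"
proof (rule d_TV_leI)
  show "measure_pmf.prob Q S - measure_pmf.prob P S \<le> 1" for S
    using measure_pmf.prob_le_1[of Q S] measure_nonneg[of "measure_pmf P" S] by linarith
qed

lemma advantage_le_d_circ: "A \<in> circuits m t \<Longrightarrow> advantage A P Q \<le> d_circ m t P Q"
  unfolding d_circ_eq_Max by (intro Max_ge) (auto simp: finite_circuits)

lemma d_circ_leI: "(\<And>A. A \<in> circuits m t \<Longrightarrow> advantage A P Q \<le> c) \<Longrightarrow> d_circ m t P Q \<le> c"
  unfolding d_circ_def by (intro cSUP_least circuits_nonempty)

lemma advantage_nonneg: "advantage A P Q \<ge> 0"
  by (simp add: advantage_def)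

lemma d_circ_nonneg: "d_circ m t P Q \<ge> 0"
  using circuits_nonempty advantage_le_d_circ advantage_nonneg by (metis all_not_in_conv order_trans)

lemma advantage_eq_prob:
  "advantage A P Q =
    \<bar>measure_pmf.prob P {z. circuit_eval A z} - measure_pmf.prob Q {z. circuit_eval A z}\<bar>"
proof -
  have "(\<lambda>z. of_bool (circuit_eval A z) :: real) = indicator {z. circuit_eval A z}"
    by (auto simp: indicator_def)
  then show ?thesis by (simp add: advantage_def)
qed

section \<open>Products as concatenated blocks\<close>

lemma finite_bitstrings: "finite (bitstrings n)"
  using finite_lists_length_eq[of "UNIV :: bool set" n] by (simp add: bitstrings_def)

lemma length_concat_uniform: "(\<And>x. x \<in> set xs \<Longrightarrow> length x = n) \<Longrightarrow> length (concat xs) = n * length xs"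
  by (induction xs) auto

lemma nth_concat_uniform:
  assumes "\<And>x. x \<in> set xs \<Longrightarrow> length x = n" "j < length xs" "i < n"
  shows "concat xs ! (n * j + i) = xs ! j ! i"
  using assms
proof (induction xs arbitrary: j)
  case (Cons x xs)
  then show ?case by (cases j) (auto simp: nth_append)
qed simp

lemma block_concat:
  assumes "\<And>x. x \<in> set xs \<Longrightarrow> length x = n" "j < length xs"
  shows "block n j (concat xs) = xs ! j"
  using assms nth_concat_uniform[OF assms(1)] by (auto simp: block_def intro!: nth_equalityI)

lemma prob_k_fold: "measure_pmf.prob (k_fold k D) S = measure_pmf.prob (replicate_pmf k D) {xs. concat xs \<in> S}"
  by (simp add: k_fold_def vimage_def)

text \<open>Hardwiring all samples but one into a circuit costs nothing, since constants are free.\<close>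

lemma advantage_k_fold_le:
  assumes D: "set_pmf D \<subseteq> bitstrings n" "set_pmf E \<subseteq> bitstrings n"
    and A: "A \<in> circuits (n * k) s" and \<beta>: "d_circ n s D E \<le> \<beta>"
  shows "advantage A (k_fold k D) (k_fold k E) \<le> real k * \<beta>"
proof -
  let ?F = "\<lambda>xs. of_bool (circuit_eval A (concat xs)) :: real"
  have "\<bar>measure_pmf.expectation D (\<lambda>x. ?F (us @ x # vs)) -
       measure_pmf.expectation E (\<lambda>x. ?F (us @ x # vs))\<bar> \<le> \<beta>"
    if us: "set us \<subseteq> bitstrings n" and vs: "set vs \<subseteq> bitstrings n"
      and len: "length us + length vs + 1 = k" for us vs
  proof -
    let ?l = "n * length us"
    define \<sigma> where "\<sigma> i = (if i < ?l then Const (concat us ! i) else if i < ?l + n then Input (i - ?l)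
      else Const (concat vs ! (i - ?l - n)))" for i
    have l: "length (concat us) = ?l" "length (concat vs) = n * length vs"
      using us vs by (auto intro!: length_concat_uniform simp: bitstrings_def)
    have "?l + n + n * length vs = n * k" using len by (auto simp flip: len simp: algebra_simps)
    then have eval: "map (\<lambda>i. wire_val z [] (\<sigma> i)) [0..<n * k] = concat (us @ z # vs)"
      if "z \<in> bitstrings n" for z
      using that l by (intro nth_equalityI) (auto simp: \<sigma>_def nth_append bitstrings_def)
    obtain A' where A': "A' \<in> circuits n (0 + s)"
      "\<And>z. z \<in> bitstrings n \<Longrightarrow> circuit_eval A' z =
         circuit_eval A (map (\<lambda>i. wire_val z [] (\<sigma> i)) [0..<n * k])"
      by (rule computable_circuit_exists[OF computable_subst_circuit[OF computable_empty A, of n \<sigma>] insertI1])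
        (auto simp: \<sigma>_def)
    have "advantage A' D E = \<bar>measure_pmf.expectation D (\<lambda>x. ?F (us @ x # vs)) -
       measure_pmf.expectation E (\<lambda>x. ?F (us @ x # vs))\<bar>"
      using A'(2) eval D unfolding advantage_def
      by (simp add: expectation_finite_support[OF finite_bitstrings D(1)]
          expectation_finite_support[OF finite_bitstrings D(2)])
    moreover have "advantage A' D E \<le> d_circ n s D E" using A'(1) by (intro advantage_le_d_circ) simp
    ultimately show ?thesis using \<beta> by linarith
  qed
  then show ?thesis
    using replicate_pmf_hybrid[OF finite_bitstrings D, where F = ?F and k = k and \<beta> = \<beta>]
    by (simp add: advantage_def k_fold_def)
qed

text \<open>The lower bound of both claims: a triangle inequality for each circuit, passing through
  the products of \<open>E0\<close> and \<open>E1\<close>. The two errors are kept apart because one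
  claim splits \<epsilon> as \<open>\<epsilon> / 2 + \<epsilon> / 2\<close> and the other as
  \<open>0 + \<epsilon>\<close>.\<close>

lemma d_circ_k_fold_le_d_TV:
  assumes D: "set_pmf D0 \<subseteq> bitstrings n" "set_pmf D1 \<subseteq> bitstrings n"
    and E: "set_pmf E0 \<subseteq> bitstrings n" "set_pmf E1 \<subseteq> bitstrings n"
    and "d_circ n s D0 E0 \<le> \<beta>0" "d_circ n s D1 E1 \<le> \<beta>1"
  shows "d_circ (n * k) s (k_fold k D0) (k_fold k D1) - real k * (\<beta>0 + \<beta>1)
    \<le> d_TV (k_fold k E0) (k_fold k E1)"
proof -
  have "d_circ (n * k) s (k_fold k D0) (k_fold k D1)
    \<le> real k * (\<beta>0 + \<beta>1) + d_TV (k_fold k E0) (k_fold k E1)"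
  proof (rule d_circ_leI)
    fix A assume A: "A \<in> circuits (n * k) s"
    have "advantage A (k_fold k D0) (k_fold k D1) \<le> advantage A (k_fold k D0) (k_fold k E0) +
      advantage A (k_fold k D1) (k_fold k E1) + advantage A (k_fold k E0) (k_fold k E1)"
      unfolding advantage_def by linarith
    also have "\<dots> \<le> real k * \<beta>0 + real k * \<beta>1 + d_TV (k_fold k E0) (k_fold k E1)"
      using advantage_k_fold_le[OF D(1) E(1) A assms(5)] advantage_k_fold_le[OF D(2) E(2) A assms(6)]
        d_TV_upper[of "k_fold k E0" _ "k_fold k E1"] unfolding advantage_eq_prob by (meson add_mono)
    finally show "advantage A (k_fold k D0) (k_fold k D1)
        \<le> real k * (\<beta>0 + \<beta>1) + d_TV (k_fold k E0) (k_fold k E1)"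
      by (simp add: algebra_simps)
  qed
  then show ?thesis by linarith
qed

section \<open>Mixtures of two distributions\<close>

definition mix :: "real \<Rightarrow> 'a pmf \<Rightarrow> 'a pmf \<Rightarrow> 'a pmf" where
  "mix \<delta> P Q = bernoulli_pmf \<delta> \<bind> (\<lambda>b. if b then Q else P)"

lemma pmf_mix: "0 \<le> \<delta> \<Longrightarrow> \<delta> \<le> 1 \<Longrightarrow> pmf (mix \<delta> P Q) x = (1 - \<delta>) * pmf P x + \<delta> * pmf Q x"
  by (simp add: mix_def pmf_bind)

lemma set_mix: "set_pmf (mix \<delta> P Q) \<subseteq> set_pmf P \<union> set_pmf Q"
  by (auto simp: mix_def split: if_splits)

lemma prob_mix:
  assumes "0 \<le> \<delta>" "\<delta> \<le> 1" "finite (set_pmf P)" "finite (set_pmf Q)"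
  shows "measure_pmf.prob (mix \<delta> P Q) S = (1 - \<delta>) * measure_pmf.prob P S + \<delta> * measure_pmf.prob Q S"
proof -
  let ?X = "set_pmf P \<union> set_pmf Q"
  have X: "finite ?X" using assms by simp
  show ?thesis
    using assms prob_finite_support[OF X set_mix] prob_finite_support[OF X, of P] prob_finite_support[OF X, of Q]
    by (simp add: pmf_mix sum_distrib_left sum.distrib sum_subtractf algebra_simps)
qed

lemma prob_mix_diff:
  assumes "0 \<le> \<delta>" "\<delta> \<le> 1" "finite (set_pmf P)" "finite (set_pmf Q)"
  shows "\<bar>measure_pmf.prob P S - measure_pmf.prob (mix \<delta> P Q) S\<bar> \<le> \<delta> * d_TV P Q"
proof -
  have "measure_pmf.prob P S - measure_pmf.prob (mix \<delta> P Q) S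
      = \<delta> * (measure_pmf.prob P S - measure_pmf.prob Q S)"
    by (simp add: prob_mix[OF assms] algebra_simps)
  then show ?thesis using d_TV_upper[of P S Q] assms(1) by (simp add: abs_mult mult_left_mono)
qed

section \<open>A threshold test for products\<close>

lemma map_replicate_pmf: "map_pmf (map f) (replicate_pmf k P) = replicate_pmf k (map_pmf f P)"
proof (induction k)
  case (Suc k)
  show ?case by (simp add: map_bind_pmf bind_map_pmf Suc.IH[symmetric])
qed simp

lemma pmf_replicate_pmf: "pmf (replicate_pmf (length xs) P) xs = (\<Prod>x\<leftarrow>xs. pmf P x)"
proof (induction xs)
  case (Cons x xs)
  have eq: "replicate_pmf (Suc k) P = map_pmf (\<lambda>(x, xs). x # xs) (pair_pmf P (replicate_pmf k P))" for k
    by (simp add: pair_pmf_def map_bind_pmf bind_return_pmf)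
  have "inj (\<lambda>(x, xs). x # xs :: 'a list)" by (auto intro: injI)
  from pmf_map_inj'[OF this, of _ "(x, xs)"]
  have "pmf (replicate_pmf (Suc (length xs)) P) (x # xs) = pmf P x * (\<Prod>x\<leftarrow>xs. pmf P x)"
    unfolding eq by (simp add: pmf_pair Cons)
  then show ?case by (simp del: replicate_pmf.simps)
qed simp

text \<open>Approximate Neyman-Pearson: at a point \<open>u\<close> where the two tests disagree,
  \<open>S'\<close> gains at most \<open>c * pmf P u\<close> over \<open>S\<close>, and these gains
  add up to at most \<open>c\<close>.\<close>

lemma near_optimal_test:
  assumes U: "finite U" "set_pmf P \<subseteq> U" "set_pmf Q \<subseteq> U" and "c \<ge> 0"
    and in_S: "\<And>u. u \<in> U \<Longrightarrow> u \<in> S \<Longrightarrow> pmf P u \<le> pmf Q u"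
    and not_in_S: "\<And>u. u \<in> U \<Longrightarrow> u \<notin> S \<Longrightarrow> pmf Q u \<le> (1 + c) * pmf P u"
  shows "measure_pmf.prob Q S' - measure_pmf.prob P S'
    \<le> measure_pmf.prob Q S - measure_pmf.prob P S + c"
proof -
  have "(pmf Q u - pmf P u) * (indicator S' u - indicator S u) \<le> c * pmf P u" if "u \<in> U" for u
    using in_S[OF that] not_in_S[OF that] mult_nonneg_nonneg[OF \<open>c \<ge> 0\<close> pmf_nonneg[of P u]]
    by (auto simp: indicator_def algebra_simps)
  then have "(\<Sum>u\<in>U. (pmf Q u - pmf P u) * (indicator S' u - indicator S u)) \<le> (\<Sum>u\<in>U. c * pmf P u)"
    by (rule sum_mono)
  also have "\<dots> = c" using sum_pmf_finite_support[OF U(1,2)] by (simp flip: sum_distrib_left)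
  also have "(\<Sum>u\<in>U. (pmf Q u - pmf P u) * (indicator S' u - indicator S u)) =
     (\<Sum>u\<in>U. pmf Q u * indicator S' u) - (\<Sum>u\<in>U. pmf P u * indicator S' u)
     - ((\<Sum>u\<in>U. pmf Q u * indicator S u) - (\<Sum>u\<in>U. pmf P u * indicator S u))"
    by (simp only: sum_subtractf[symmetric]) (simp add: algebra_simps)
  finally show ?thesis
    by (simp only: prob_finite_support[OF U(1,2)] prob_finite_support[OF U(1,3)])
qed

text \<open>The likelihood ratio of \<open>mix \<delta> Q P\<close> to
  \<open>mix \<delta> P Q\<close> at a point where \<open>P\<close> and \<open>Q\<close> have masses
  \<open>p\<close> and \<open>q\<close>. Smoothing keeps it between \<delta> and
  \<open>1 / \<delta>\<close>, so that its logarithm has bounded range.\<close>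

definition smoothed_ratio :: "real \<Rightarrow> real \<Rightarrow> real \<Rightarrow> real" where
  "smoothed_ratio \<delta> p q = ((1 - \<delta>) * q + \<delta> * p) / ((1 - \<delta>) * p + \<delta> * q)"

text \<open>A bound for the absolute value of the logarithm of the smoothed ratio.\<close>

definition score_offset :: "real \<Rightarrow> real \<Rightarrow> nat" where
  "score_offset \<delta> \<gamma> = nat \<lceil>log (1 + \<gamma>) (1 / \<delta>)\<rceil>"

text \<open>
  The log-likelihood ratio in base \<open>1 + \<gamma>\<close>, rounded down and shifted to be nonnegative. The
  truncation at \<open>2 * score_offset \<delta> \<gamma>\<close> only matters for the junk arguments \<open>p = q = 0\<close>.
\<close>

definition score :: "real \<Rightarrow> real \<Rightarrow> real \<Rightarrow> real \<Rightarrow> nat" where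
  "score \<delta> \<gamma> p q = min (2 * score_offset \<delta> \<gamma>)
     (nat (\<lfloor>log (1 + \<gamma>) (smoothed_ratio \<delta> p q)\<rfloor> + int (score_offset \<delta> \<gamma>)))"

lemma score_le: "score \<delta> \<gamma> p q \<le> 2 * score_offset \<delta> \<gamma>"
  by (simp add: score_def)

text \<open>The smoothed ratio is homogeneous of degree 0. Hence a factor common to both masses,
  such as a shared conditional probability inside a label class, cancels and the score depends on
  the label alone.\<close>

lemma score_scale: "a > 0 \<Longrightarrow> score \<delta> \<gamma> (p * a) (q * a) = score \<delta> \<gamma> p q"
proof -
  assume "a > 0"
  have "smoothed_ratio \<delta> (p * a) (q * a) =
    (((1 - \<delta>) * q + \<delta> * p) * a) / (((1 - \<delta>) * p + \<delta> * q) * a)"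
    by (simp add: smoothed_ratio_def algebra_simps)
  also have "\<dots> = smoothed_ratio \<delta> p q" using \<open>a > 0\<close> by (simp add: smoothed_ratio_def)
  finally show ?thesis by (simp add: score_def)
qed

lemma smoothed_ratio_bounds:
  assumes \<delta>: "0 < \<delta>" "\<delta> \<le> 1/2" and p: "p \<ge> 0" "q \<ge> 0" "p + q > 0"
  shows "(1 - \<delta>) * p + \<delta> * q > 0" "(1 - \<delta>) * q + \<delta> * p > 0"
    "\<delta> \<le> smoothed_ratio \<delta> p q" "smoothed_ratio \<delta> p q \<le> 1 / \<delta>"
proof -
  have pos: "(1 - \<delta>) * p + \<delta> * q > 0" if "p \<ge> 0" "q \<ge> 0" "p + q > 0" for p q
  proof -
    have "0 < \<delta> * (p + q)" using that \<delta> by simp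
    also have "\<dots> \<le> (1 - \<delta>) * p + \<delta> * q"
      using mult_right_mono[of \<delta> "1 - \<delta>" p] that \<delta> by (simp add: algebra_simps)
    finally show ?thesis .
  qed
  show 1: "(1 - \<delta>) * p + \<delta> * q > 0" and 2: "(1 - \<delta>) * q + \<delta> * p > 0"
    using pos[of p q] pos[of q p] p by (simp_all add: add.commute)
  have le: "\<delta> * ((1 - \<delta>) * p + \<delta> * q) \<le> (1 - \<delta>) * q + \<delta> * p" if "p \<ge> 0" "q \<ge> 0" for p q
  proof -
    have "\<delta> * \<delta> \<le> 1/2 * (1/2)" using \<delta> by (intro mult_mono) auto
    then have "\<delta> * \<delta> * q \<le> (1 - \<delta>) * q" using \<delta> that by (intro mult_right_mono) auto
    moreover have "0 \<le> \<delta> * \<delta> * p" using \<delta> that by simp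
    ultimately show ?thesis by (simp add: algebra_simps)
  qed
  show "\<delta> \<le> smoothed_ratio \<delta> p q"
    using 1 le[OF p(1,2)] by (simp add: smoothed_ratio_def pos_le_divide_eq)
  show "smoothed_ratio \<delta> p q \<le> 1 / \<delta>"
    using 1 \<delta> le[OF p(2,1)] by (simp add: smoothed_ratio_def field_simps)
qed

lemma score_bounds:
  assumes \<delta>: "0 < \<delta>" "\<delta> \<le> 1/2" and p: "p \<ge> 0" "q \<ge> 0" "p + q > 0" and \<gamma>: "\<gamma> > 0"
  defines "l \<equiv> log (1 + \<gamma>) (smoothed_ratio \<delta> p q)"
  shows "real (score \<delta> \<gamma> p q) - real (score_offset \<delta> \<gamma>) \<le> l"
    "l - 1 < real (score \<delta> \<gamma> p q) - real (score_offset \<delta> \<gamma>)"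
proof -
  let ?o = "score_offset \<delta> \<gamma>"
  note r = smoothed_ratio_bounds[OF \<delta> p]
  have "log (1 + \<gamma>) (1 / \<delta>) \<ge> 0" using \<delta> \<gamma> by simp
  then have o: "log (1 + \<gamma>) (1 / \<delta>) \<le> real ?o"
    unfolding score_offset_def by (simp add: le_of_int_ceiling)
  have "l \<le> log (1 + \<gamma>) (1 / \<delta>)" using r \<gamma> \<delta> unfolding l_def by (intro log_mono) auto
  moreover have "log (1 + \<gamma>) \<delta> \<le> l" using r \<gamma> \<delta> unfolding l_def by (intro log_mono) auto
  moreover have "log (1 + \<gamma>) (1 / \<delta>) = - log (1 + \<gamma>) \<delta>" using \<delta> by (simp add: log_divide)
  ultimately have l: "- real ?o \<le> l" "l \<le> real ?o" using o by linarith+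
  \<comment> \<open>In this range neither \<open>nat\<close> nor \<open>min\<close> changes the
    value in the definition of \<open>score\<close>.\<close>
  then have f: "- int ?o \<le> \<lfloor>l\<rfloor>" "\<lfloor>l\<rfloor> \<le> int ?o" by linarith+
  then have "int (score \<delta> \<gamma> p q) = \<lfloor>l\<rfloor> + int ?o" 
    by (simp add: score_def l_def[symmetric] min_absorb2 nat_le_iff)
  then have "real (score \<delta> \<gamma> p q) = of_int \<lfloor>l\<rfloor> + real ?o" by linarith
  then show "real (score \<delta> \<gamma> p q) - real ?o \<le> l" "l - 1 < real (score \<delta> \<gamma> p q) - real ?o"
    by linarith+
qed

lemma one_plus_power_le:
  fixes \<gamma> :: real
  assumes "0 \<le> \<gamma>" "real k * \<gamma> \<le> 1"
  shows "(1 + \<gamma>) ^ k \<le> 1 + 2 * (real k * \<gamma>)"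
proof -
  have "(1 + \<gamma>) ^ k \<le> exp \<gamma> ^ k" using assms exp_ge_add_one_self[of \<gamma>] by (intro power_mono) auto
  also have "\<dots> = exp (real k * \<gamma>)" by (simp add: exp_of_nat_mult)
  also have "\<dots> \<le> 1 + real k * \<gamma> + (real k * \<gamma>)\<^sup>2" using assms by (intro exp_bound) auto
  also have "(real k * \<gamma>)\<^sup>2 \<le> real k * \<gamma>"
    using assms mult_left_mono[of "real k * \<gamma>" 1 "real k * \<gamma>"] by (simp add: power2_eq_square)
  finally show ?thesis by linarith
qed

text \<open>For the smoothed pair the sum of scores decides, up to rounding, whether the likelihood
  ratio of the products is at least 1. Rounding costs a factor of at most
  \<open>(1 + \<gamma>) ^ k\<close>, hence \<open>2 * k * \<gamma>\<close>; replacing the pair by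
  the smoothed one costs \<open>k * \<delta>\<close> in each of four probabilities.\<close>

lemma sum_score_test:
  fixes P Q :: "'a pmf"
  assumes fin: "finite (set_pmf P)" "finite (set_pmf Q)"
    and \<delta>: "0 < \<delta>" "\<delta> \<le> 1/2" and \<gamma>: "\<gamma> > 0" "real k * \<gamma> \<le> 1"
  defines "S \<equiv> {xs. k * score_offset \<delta> \<gamma> \<le> (\<Sum>x\<leftarrow>xs. score \<delta> \<gamma> (pmf P x) (pmf Q x))}"
  shows "measure_pmf.prob (replicate_pmf k Q) S' - measure_pmf.prob (replicate_pmf k P) S'
    \<le> measure_pmf.prob (replicate_pmf k Q) S - measure_pmf.prob (replicate_pmf k P) S
      + 4 * real k * \<delta> + 2 * real k * \<gamma>"
proof -
  let ?o = "score_offset \<delta> \<gamma>"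
  define w where "w x = score \<delta> \<gamma> (pmf P x) (pmf Q x)" for x
  define P' where "P' = mix \<delta> P Q"
  define Q' where "Q' = mix \<delta> Q P"
  let ?X = "set_pmf P \<union> set_pmf Q"
  have X: "finite ?X" "set_pmf P' \<subseteq> ?X" "set_pmf Q' \<subseteq> ?X" "set_pmf P \<subseteq> ?X" "set_pmf Q \<subseteq> ?X"
    using fin set_mix[of \<delta> P Q] set_mix[of \<delta> Q P] by (auto simp: P'_def Q'_def)
  define l where "l x = log (1 + \<gamma>) (smoothed_ratio \<delta> (pmf P x) (pmf Q x))" for x
  have pos: "pmf P x + pmf Q x > 0" if "x \<in> ?X" for x
  proof -
    have "pmf P x > 0 \<or> pmf Q x > 0" using that by (auto simp: pmf_positive_iff)
    then show ?thesis by (auto intro: add_pos_nonneg add_nonneg_pos)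
  qed
  have w: "real (w x) - real ?o \<le> l x" "l x - 1 < real (w x) - real ?o" if "x \<in> ?X" for x
    using score_bounds[OF \<delta> _ _ pos[OF that] \<gamma>(1)] by (simp_all add: w_def l_def)
  have Q'_eq: "pmf Q' x = pmf P' x * (1 + \<gamma>) powr l x" if "x \<in> ?X" for x
    using smoothed_ratio_bounds[OF \<delta> _ _ pos[OF that]] \<gamma> \<delta>
    by (simp add: l_def P'_def Q'_def pmf_mix powr_log_cancel smoothed_ratio_def)
  define U where "U = {xs. set xs \<subseteq> ?X \<and> length xs = k}"
  have U: "finite U" "set_pmf (replicate_pmf k P') \<subseteq> U" "set_pmf (replicate_pmf k Q') \<subseteq> U"
    using X finite_lists_length_eq[of ?X k] by (auto simp: U_def set_replicate_pmf)
  have prod: "(\<Prod>x\<leftarrow>xs. pmf Q' x) = (\<Prod>x\<leftarrow>xs. pmf P' x) * (1 + \<gamma>) powr (\<Sum>x\<leftarrow>xs. l x)"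
    if "set xs \<subseteq> ?X" for xs
    using that by (induction xs) (use \<gamma> Q'_eq in \<open>auto simp: powr_add\<close>)
  have sum: "real (\<Sum>x\<leftarrow>xs. w x) - real (length xs * ?o) \<le> (\<Sum>x\<leftarrow>xs. l x)"
    "(\<Sum>x\<leftarrow>xs. l x) - real (length xs) \<le> real (\<Sum>x\<leftarrow>xs. w x) - real (length xs * ?o)"
    if "set xs \<subseteq> ?X" for xs
  proof -
    have "real (\<Sum>x\<leftarrow>xs. w x) - real (length xs * ?o) \<le> (\<Sum>x\<leftarrow>xs. l x) \<and>
      (\<Sum>x\<leftarrow>xs. l x) - real (length xs) \<le> real (\<Sum>x\<leftarrow>xs. w x) - real (length xs * ?o)"
      using that
    proof (induction xs)
      case (Cons x xs)
      then show ?case using w[of x] by (simp add: algebra_simps)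
    qed simp
    then show "real (\<Sum>x\<leftarrow>xs. w x) - real (length xs * ?o) \<le> (\<Sum>x\<leftarrow>xs. l x)"
      "(\<Sum>x\<leftarrow>xs. l x) - real (length xs) \<le> real (\<Sum>x\<leftarrow>xs. w x) - real (length xs * ?o)" by auto
  qed
  have "measure_pmf.prob (replicate_pmf k Q') S' - measure_pmf.prob (replicate_pmf k P') S'
    \<le> measure_pmf.prob (replicate_pmf k Q') S - measure_pmf.prob (replicate_pmf k P') S + 2 * (real k * \<gamma>)"
  proof (rule near_optimal_test[OF U])
    \<comment> \<open>Scores are rounded down, so passing the threshold forces a nonnegative
      log-likelihood ratio.\<close>
    fix xs assume xs: "xs \<in> U" "xs \<in> S"
    have nonneg: "(\<Prod>x\<leftarrow>xs. pmf P' x) \<ge> 0" by (rule prod_list_nonneg) auto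
    have "real (k * ?o) \<le> real (\<Sum>x\<leftarrow>xs. w x)" using xs(2) unfolding S_def w_def by (simp only: mem_Collect_eq of_nat_le_iff)
    then have "(\<Sum>x\<leftarrow>xs. l x) \<ge> 0" using sum(1)[of xs] xs(1) by (auto simp: U_def)
    then have "(1 + \<gamma>) powr (\<Sum>x\<leftarrow>xs. l x) \<ge> 1" using \<gamma> by (intro ge_one_powr_ge_zero) auto
    then show "pmf (replicate_pmf k P') xs \<le> pmf (replicate_pmf k Q') xs"
      using pmf_replicate_pmf[of xs] prod[of xs] xs(1) mult_left_mono[OF _ nonneg] by (fastforce simp: U_def)
  next
    \<comment> \<open>Rounding loses at most one unit per sample, so below the threshold the
      log-likelihood ratio is at most \<open>k\<close>.\<close>
    fix xs assume xs: "xs \<in> U" "xs \<notin> S"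
    have nonneg: "(\<Prod>x\<leftarrow>xs. pmf P' x) \<ge> 0" by (rule prod_list_nonneg) auto
    have "real (\<Sum>x\<leftarrow>xs. w x) \<le> real (k * ?o)" using xs(2) unfolding S_def w_def
      by (simp only: mem_Collect_eq of_nat_le_iff not_le less_imp_le)
    then have "(\<Sum>x\<leftarrow>xs. l x) \<le> real k" using sum(2)[of xs] xs(1) by (auto simp: U_def)
    then have "(1 + \<gamma>) powr (\<Sum>x\<leftarrow>xs. l x) \<le> (1 + \<gamma>) powr real k" using \<gamma> by (intro powr_mono) auto
    also have "\<dots> = (1 + \<gamma>) ^ k" using \<gamma> by (simp add: powr_realpow)
    also have "\<dots> \<le> 1 + 2 * (real k * \<gamma>)" using \<gamma> by (intro one_plus_power_le) auto
    finally have "(1 + \<gamma>) powr (\<Sum>x\<leftarrow>xs. l x) \<le> 1 + 2 * (real k * \<gamma>)" .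
    from mult_left_mono[OF this nonneg]
    show "pmf (replicate_pmf k Q') xs \<le> (1 + 2 * (real k * \<gamma>)) * pmf (replicate_pmf k P') xs"
      using pmf_replicate_pmf[of xs] prod[of xs] xs(1) by (auto simp: U_def mult.commute)
  qed (use \<gamma> in auto)
  moreover have "\<bar>measure_pmf.prob P V - measure_pmf.prob P' V\<bar> \<le> \<delta>"
    "\<bar>measure_pmf.prob Q V - measure_pmf.prob Q' V\<bar> \<le> \<delta>" for V
    using prob_mix_diff[of \<delta> P Q V] prob_mix_diff[of \<delta> Q P V] \<delta> fin
      mult_left_le[OF d_TV_le_1[of P Q], of \<delta>] mult_left_le[OF d_TV_le_1[of Q P], of \<delta>]
    unfolding P'_def Q'_def by linarith+
  then have "\<bar>measure_pmf.prob (replicate_pmf k P) V - measure_pmf.prob (replicate_pmf k P') V\<bar> \<le> real k * \<delta>"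
    "\<bar>measure_pmf.prob (replicate_pmf k Q) V - measure_pmf.prob (replicate_pmf k Q') V\<bar> \<le> real k * \<delta>" for V
    using X by (auto intro!: prob_replicate_pmf_hybrid[of ?X])
  note this[of S] this[of S']
  ultimately show ?thesis by linarith
qed

text \<open>Bounding \<open>ln (1 / \<delta>)\<close> by \<open>1 / \<delta>\<close> is good enough,
  because the offset only enters the part of the circuit size that is polynomial in
  \<open>k / \<epsilon>\<close>.\<close>

lemma score_offset_le:
  assumes "0 < \<delta>" "\<delta> \<le> 1" "0 < \<gamma>" "\<gamma> \<le> 1/2"
  shows "real (score_offset \<delta> \<gamma>) \<le> 2 / (\<delta> * \<gamma>) + 1"
proof -
  have "\<gamma> / 2 \<le> \<gamma> - \<gamma>\<^sup>2" using assms mult_left_mono[of \<gamma> "1/2" \<gamma>] by (simp add: power2_eq_square)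
  also have "\<dots> \<le> ln (1 + \<gamma>)" using assms by (intro ln_one_plus_pos_lower_bound) auto
  finally have *: "\<gamma> / 2 \<le> ln (1 + \<gamma>)" .
  have "log (1 + \<gamma>) (1 / \<delta>) = ln (1 / \<delta>) / ln (1 + \<gamma>)" by (simp add: log_def)
  also have "\<dots> \<le> (1 / \<delta>) / (\<gamma> / 2)"
    using * assms ln_le_minus_one[of "1 / \<delta>"] by (intro frac_le) auto
  also have "\<dots> = 2 / (\<delta> * \<gamma>)" by simp
  finally have "log (1 + \<gamma>) (1 / \<delta>) \<le> 2 / (\<delta> * \<gamma>)" .
  moreover have "log (1 + \<gamma>) (1 / \<delta>) \<ge> 0" using assms by simp
  ultimately show ?thesis unfolding score_offset_def by linarith
qed

section \<open>Calibrated labellings\<close>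

lemma sum_label:
  fixes v :: "nat \<Rightarrow> real"
  assumes "finite X" "set_pmf D \<subseteq> X" "\<And>x. g x < L"
  shows "(\<Sum>x\<in>X. pmf D x * v (g x)) = (\<Sum>c<L. pmf (map_pmf g D) c * v c)"
proof -
  have "(\<Sum>x\<in>X. pmf D x * v (g x)) = measure_pmf.expectation (map_pmf g D) v"
    using expectation_finite_support[OF assms(1,2), of "\<lambda>x. v (g x)"] by simp
  also have "\<dots> = (\<Sum>c<L. pmf (map_pmf g D) c * v c)"
    using assms(3) by (intro expectation_finite_support) auto
  finally show ?thesis .
qed

text \<open>The conditional mean of \<open>f = D1 / \<mu>\<close> on the label \<open>c\<close>; it
  is 0 by division by zero if both distributions miss \<open>c\<close>.\<close>

definition posterior :: "'a pmf \<Rightarrow> 'a pmf \<Rightarrow> ('a \<Rightarrow> nat) \<Rightarrow> nat \<Rightarrow> real" where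
  "posterior D0 D1 g c =
     pmf (map_pmf g D1) c / (pmf (map_pmf g D0) c + pmf (map_pmf g D1) c)"

lemma posterior_bounds: "0 \<le> posterior D0 D1 g c" "posterior D0 D1 g c \<le> 1"
proof -
  have "q / (p + q) \<le> 1" if "p \<ge> 0" "q \<ge> 0" for p q :: real
    using that by (cases "p + q = 0") (auto simp: divide_le_eq_1)
  then show "0 \<le> posterior D0 D1 g c" "posterior D0 D1 g c \<le> 1" by (simp_all add: posterior_def)
qed

text \<open>
  With \<open>\<mu> = D0 + D1\<close> and \<open>f = D1 / \<mu>\<close> this is the squared error \<open>\<Sum>x. \<mu> x * (f x - h x)\<^sup>2\<close>
  up to an additive constant independent of \<open>h\<close>.
\<close>

definition energy :: "'a set \<Rightarrow> 'a pmf \<Rightarrow> 'a pmf \<Rightarrow> ('a \<Rightarrow> real) \<Rightarrow> real" where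
  "energy X D0 D1 h = (\<Sum>x\<in>X. (pmf D0 x + pmf D1 x) * (h x)\<^sup>2 - 2 * pmf D1 x * h x)"

text \<open>At each \<open>x\<close> the summand plus \<open>pmf D1 x\<close> equals
  \<open>D1 * (h - 1)\<^sup>2 + D0 * h\<^sup>2\<close>. This floor limits how often the energy can
  drop.\<close>

lemma energy_ge:
  assumes "finite X" "set_pmf D1 \<subseteq> X"
  shows "energy X D0 D1 h \<ge> - 1"
proof -
  have "- pmf D1 x \<le> (pmf D0 x + pmf D1 x) * (h x)\<^sup>2 - 2 * pmf D1 x * h x" for x
  proof -
    have "0 \<le> pmf D1 x * (h x - 1)\<^sup>2" "0 \<le> pmf D0 x * (h x)\<^sup>2" by simp_all
    then show ?thesis by (simp add: power2_eq_square algebra_simps)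
  qed
  then have "(\<Sum>x\<in>X. - pmf D1 x) \<le> energy X D0 D1 h" unfolding energy_def by (rule sum_mono)
  then show ?thesis using sum_pmf_finite_support[OF assms] by (simp add: sum_negf)
qed

lemma energy_label:
  fixes g :: "'a \<Rightarrow> nat"
  assumes "finite X" "set_pmf D0 \<subseteq> X" "set_pmf D1 \<subseteq> X" "\<And>x. g x < L"
  shows "energy X D0 D1 (\<lambda>x. v (g x)) = (\<Sum>c<L.
    (pmf (map_pmf g D0) c + pmf (map_pmf g D1) c) * (v c)\<^sup>2 - 2 * pmf (map_pmf g D1) c * v c)"
proof -
  have "energy X D0 D1 (\<lambda>x. v (g x)) =
    (\<Sum>x\<in>X. pmf D0 x * (v (g x))\<^sup>2) + (\<Sum>x\<in>X. pmf D1 x * ((v (g x))\<^sup>2 - 2 * v (g x)))"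
    unfolding energy_def by (simp add: sum.distrib[symmetric] algebra_simps)
  also have "\<dots> = (\<Sum>c<L. pmf (map_pmf g D0) c * (v c)\<^sup>2) +
      (\<Sum>c<L. pmf (map_pmf g D1) c * ((v c)\<^sup>2 - 2 * v c))"
    using sum_label[OF assms(1,2,4), of "\<lambda>c. (v c)\<^sup>2"]
      sum_label[OF assms(1,3,4), of "\<lambda>c. (v c)\<^sup>2 - 2 * v c"] by simp
  also have "\<dots> = (\<Sum>c<L.
    (pmf (map_pmf g D0) c + pmf (map_pmf g D1) c) * (v c)\<^sup>2 - 2 * pmf (map_pmf g D1) c * v c)"
    by (simp add: sum.distrib[symmetric] algebra_simps)
  finally show ?thesis .
qed

text \<open>The conditional mean minimises the squared error among functions of the label: complete
  the square on each label. Hence a new label may carry any guess for its value, and passing to its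
  true posterior only helps.\<close>

lemma energy_posterior_le:
  assumes "finite X" "set_pmf D0 \<subseteq> X" "set_pmf D1 \<subseteq> X" "\<And>x. g x < L"
  shows "energy X D0 D1 (\<lambda>x. posterior D0 D1 g (g x)) \<le> energy X D0 D1 (\<lambda>x. v (g x))"
  unfolding energy_label[OF assms, of "posterior D0 D1 g"] energy_label[OF assms, of v]
proof (rule sum_mono)
  fix c
  define p where "p = pmf (map_pmf g D0) c"
  define q where "q = pmf (map_pmf g D1) c"
  define f where "f = q / (p + q)"
  have nn: "p \<ge> 0" "q \<ge> 0" by (simp_all add: p_def q_def)
  then have q: "q = (p + q) * f" unfolding f_def by (cases "p + q = 0") auto
  have "0 \<le> (p + q) * (v c - f)\<^sup>2" using nn by simp
  also have "\<dots> = (p + q) * (v c)\<^sup>2 - 2 * ((p + q) * f) * v c - ((p + q) * f\<^sup>2 - 2 * ((p + q) * f) * f)"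
    by (simp add: power2_eq_square algebra_simps)
  also have "\<dots> = (p + q) * (v c)\<^sup>2 - 2 * q * v c - ((p + q) * f\<^sup>2 - 2 * q * f)"
    by (simp only: q[symmetric])
  finally show "(pmf (map_pmf g D0) c + pmf (map_pmf g D1) c) * (posterior D0 D1 g c)\<^sup>2
      - 2 * pmf (map_pmf g D1) c * posterior D0 D1 g c
    \<le> (pmf (map_pmf g D0) c + pmf (map_pmf g D1) c) * (v c)\<^sup>2 - 2 * pmf (map_pmf g D1) c * v c"
    by (simp add: posterior_def p_def q_def f_def)
qed

text \<open>The correlation under \<open>\<mu> = D0 + D1\<close> of the residual, posterior minus
  \<open>f\<close>, with the test \<open>a\<close>, weighted by a function of the posterior. The
  weight is constantly 1 for the first claim and proportional to \<open>1 / (1 - v)\<close>, cut off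
  near \<open>v = 1\<close>, for the second.\<close>

definition calibration_error ::
  "'a set \<Rightarrow> (real \<Rightarrow> real) \<Rightarrow> 'a pmf \<Rightarrow> 'a pmf \<Rightarrow> ('a \<Rightarrow> nat) \<Rightarrow> ('a \<Rightarrow> bool) \<Rightarrow> real" where
  "calibration_error X \<omega> D0 D1 g a = (\<Sum>x\<in>X.
     ((pmf D0 x + pmf D1 x) * posterior D0 D1 g (g x) - pmf D1 x) *
     (\<omega> (posterior D0 D1 g (g x)) * of_bool (a x)))"

text \<open>A gradient step of length \<open>\<alpha> / 2\<close> against the sign of the error: the
  linear term gains \<open>\<alpha> * \<bar>Z\<bar>\<close>, more than
  \<open>\<alpha>\<^sup>2\<close>, the quadratic term costs at most
  \<open>\<alpha>\<^sup>2 / 2\<close>, and rounding at most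
  \<open>\<alpha>\<^sup>2 / 4\<close>.\<close>

lemma energy_decrement:
  assumes X: "finite X" "set_pmf D0 \<subseteq> X" "set_pmf D1 \<subseteq> X" and g: "\<And>x. g x < L"
    and \<omega>: "\<And>v. 0 \<le> \<omega> v" "\<And>v. \<omega> v \<le> 1"
    and \<alpha>: "0 < \<alpha>" "\<alpha> \<le> 1" and L: "L = nat \<lfloor>120 / \<alpha>\<^sup>2\<rfloor> + 1"
    and large: "\<bar>calibration_error X \<omega> D0 D1 g a\<bar> > \<alpha>"
  shows "\<exists>\<tau>. (\<forall>l b. \<tau> l b < L) \<and>
    energy X D0 D1 (\<lambda>x. posterior D0 D1 (\<lambda>x. \<tau> (g x) (a x)) (\<tau> (g x) (a x)))
      \<le> energy X D0 D1 (\<lambda>x. posterior D0 D1 g (g x)) - \<alpha>\<^sup>2 / 4"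
proof -
  define Z where "Z = calibration_error X \<omega> D0 D1 g a"
  define f where "f = posterior D0 D1 g"
  define \<mu> where "\<mu> x = pmf D0 x + pmf D1 x" for x
  define d where "d c b = - (\<alpha> / 2) * sgn Z * (\<omega> (f c) * of_bool b)" for c b
  define h where "h c b = f c + d c b" for c b
  \<comment> \<open>The grid width: rounding raises the energy by at most
    \<open>6 * \<gamma> = \<alpha>\<^sup>2 / 8\<close>.\<close>
  define \<gamma> where "\<gamma> = \<alpha>\<^sup>2 / 48"
  \<comment> \<open>As \<open>h\<close> lies between -1/2 and 3/2, the shift by 1 makes the grid
    index nonnegative, and it is at most \<open>(5/2) / \<gamma> = 120 / \<alpha>\<^sup>2\<close>;
    this fixes \<open>L\<close>.\<close>
  define \<tau> where "\<tau> c b = nat \<lfloor>(h c b + 1) / \<gamma>\<rfloor>" for c b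
  define r where "r c b = h c b - (real (\<tau> c b) * \<gamma> - 1)" for c b
  have \<gamma>: "\<gamma> > 0" "\<gamma> \<le> 1" using \<alpha> power_le_one[of \<alpha> 2] by (auto simp: \<gamma>_def)
  have \<mu>_nonneg: "\<mu> x \<ge> 0" for x by (simp add: \<mu>_def)
  have \<mu>_sum: "(\<Sum>x\<in>X. \<mu> x) = 2"
    by (simp add: \<mu>_def sum.distrib sum_pmf_finite_support[OF X(1,2)] sum_pmf_finite_support[OF X(1,3)])
  have d_abs: "\<bar>d c b\<bar> \<le> \<alpha> / 2" for c b
  proof -
    have "\<bar>sgn Z\<bar> \<le> 1" by (simp add: abs_sgn_eq)
    moreover have "\<bar>\<omega> (f c) * of_bool b\<bar> \<le> 1" using \<omega> by auto
    ultimately have "\<bar>sgn Z\<bar> * \<bar>\<omega> (f c) * of_bool b\<bar> \<le> 1" by (intro mult_le_one) auto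
    then have "(\<alpha> / 2) * (\<bar>sgn Z\<bar> * \<bar>\<omega> (f c) * of_bool b\<bar>) \<le> (\<alpha> / 2) * 1"
      using \<alpha> by (intro mult_left_mono) auto
    then show ?thesis using \<alpha> by (simp add: d_def abs_mult)
  qed
  have h: "- (1/2) \<le> h c b" "h c b \<le> 3/2" for c b
    using d_abs[of c b] \<alpha> posterior_bounds[of D0 D1 g c] unfolding h_def f_def by linarith+
  have r: "0 \<le> r c b" "r c b \<le> \<gamma>" for c b
  proof -
    have "0 \<le> (h c b + 1) / \<gamma>" using h(1)[of c b] \<gamma> by simp
    then have "real (\<tau> c b) \<le> (h c b + 1) / \<gamma>" "(h c b + 1) / \<gamma> \<le> real (\<tau> c b) + 1"
      unfolding \<tau>_def by linarith+
    then show "0 \<le> r c b" "r c b \<le> \<gamma>" using \<gamma> by (simp_all add: r_def field_simps)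
  qed
  have \<tau>_less: "\<tau> c b < L" for c b
  proof -
    have "(h c b + 1) / \<gamma> \<le> (5/2) / \<gamma>" using h(2)[of c b] \<gamma> by (intro divide_right_mono) auto
    also have "\<dots> = 120 / \<alpha>\<^sup>2" by (simp add: \<gamma>_def)
    finally show ?thesis unfolding L \<tau>_def by (simp add: less_Suc_eq_le nat_mono floor_mono)
  qed
  have Z_eq: "(\<Sum>x\<in>X. (\<mu> x * f (g x) - pmf D1 x) * d (g x) (a x)) = - (\<alpha> / 2) * \<bar>Z\<bar>"
  proof -
    have "(\<Sum>x\<in>X. (\<mu> x * f (g x) - pmf D1 x) * d (g x) (a x)) = (- (\<alpha> / 2) * sgn Z) * Z"
      unfolding Z_def calibration_error_def sum_distrib_left d_def \<mu>_def f_def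
      by (intro sum.cong) (auto simp: algebra_simps)
    then show ?thesis by (simp add: abs_sgn mult.commute)
  qed
  have d2: "(\<Sum>x\<in>X. \<mu> x * (d (g x) (a x))\<^sup>2) \<le> \<alpha>\<^sup>2 / 2"
  proof -
    have "(d (g x) (a x))\<^sup>2 \<le> (\<alpha> / 2)\<^sup>2" for x
      using d_abs[of "g x" "a x"] by (metis abs_ge_zero power2_abs power_mono)
    then have "(\<Sum>x\<in>X. \<mu> x * (d (g x) (a x))\<^sup>2) \<le> (\<Sum>x\<in>X. \<mu> x * (\<alpha> / 2)\<^sup>2)"
      by (intro sum_mono mult_left_mono \<mu>_nonneg)
    also have "\<dots> = 2 * (\<alpha> / 2)\<^sup>2" by (simp add: sum_distrib_right[symmetric] \<mu>_sum)
    finally show ?thesis by (simp add: power2_eq_square)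
  qed
  have "energy X D0 D1 (\<lambda>x. h (g x) (a x)) = energy X D0 D1 (\<lambda>x. f (g x)) +
      (2 * (\<Sum>x\<in>X. (\<mu> x * f (g x) - pmf D1 x) * d (g x) (a x)) + (\<Sum>x\<in>X. \<mu> x * (d (g x) (a x))\<^sup>2))"
    unfolding energy_def h_def \<mu>_def sum_distrib_left sum.distrib[symmetric]
    by (intro sum.cong) (auto simp: power2_eq_square algebra_simps)
  also have "\<dots> \<le> energy X D0 D1 (\<lambda>x. f (g x)) + (- \<alpha> * \<bar>Z\<bar> + \<alpha>\<^sup>2 / 2)"
    using d2 unfolding Z_eq by simp
  also have "\<dots> \<le> energy X D0 D1 (\<lambda>x. f (g x)) - \<alpha>\<^sup>2 / 2"
    using mult_left_mono[OF less_imp_le[OF large], of \<alpha>] \<alpha> by (simp add: Z_def power2_eq_square)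
  finally have 1: "energy X D0 D1 (\<lambda>x. h (g x) (a x)) \<le> energy X D0 D1 (\<lambda>x. f (g x)) - \<alpha>\<^sup>2 / 2" .
  \<comment> \<open>Rounding lowers \<open>y\<close> by \<open>e \<le> \<gamma> \<le> 1\<close>.
    Since \<open>y \<ge> -1/2\<close>, the quadratic part grows by at most
    \<open>2 * \<gamma>\<close> per unit of \<mu>, which has total mass 2, and the linear part by
    \<open>2 * \<gamma>\<close> per unit of \<open>D1\<close>.\<close>
  have "energy X D0 D1 (\<lambda>x. real (\<tau> (g x) (a x)) * \<gamma> - 1) - energy X D0 D1 (\<lambda>x. h (g x) (a x))
      \<le> (\<Sum>x\<in>X. \<gamma> * (2 * \<mu> x + 2 * pmf D1 x))"
    unfolding energy_def sum_subtractf[symmetric]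
  proof (rule sum_mono)
    fix x
    define y where "y = h (g x) (a x)"
    define e where "e = r (g x) (a x)"
    have e: "0 \<le> e" "e \<le> \<gamma>" using r by (auto simp: e_def)
    have \<tau>: "real (\<tau> (g x) (a x)) * \<gamma> - 1 = y - e" by (simp add: e_def r_def y_def)
    have "- 2 * y * e \<le> 1 * e" using h(1)[of "g x" "a x"] e by (intro mult_right_mono) (auto simp: y_def)
    moreover have "e * e \<le> 1 * e" using e \<gamma> by (intro mult_right_mono) auto
    ultimately have "- 2 * y * e + e * e \<le> 2 * \<gamma>" using e by linarith
    then have "\<mu> x * (- 2 * y * e + e * e) \<le> \<mu> x * (2 * \<gamma>)" by (intro mult_left_mono \<mu>_nonneg)
    moreover have "pmf D1 x * e \<le> pmf D1 x * \<gamma>" using e by (intro mult_left_mono) auto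
    moreover have "\<mu> x * (y - e)\<^sup>2 - 2 * pmf D1 x * (y - e) - (\<mu> x * y\<^sup>2 - 2 * pmf D1 x * y) =
       \<mu> x * (- 2 * y * e + e * e) + 2 * (pmf D1 x * e)"
      by (simp add: power2_eq_square algebra_simps)
    ultimately show "(pmf D0 x + pmf D1 x) * (real (\<tau> (g x) (a x)) * \<gamma> - 1)\<^sup>2 -
        2 * pmf D1 x * (real (\<tau> (g x) (a x)) * \<gamma> - 1) -
        ((pmf D0 x + pmf D1 x) * (h (g x) (a x))\<^sup>2 - 2 * pmf D1 x * h (g x) (a x))
        \<le> \<gamma> * (2 * \<mu> x + 2 * pmf D1 x)"
      unfolding \<tau> y_def[symmetric] \<mu>_def[symmetric] by (simp add: algebra_simps)
  qed
  also have "\<dots> = \<gamma> * 6"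
    by (simp add: sum_distrib_left[symmetric] sum.distrib \<mu>_sum sum_pmf_finite_support[OF X(1,3)])
  also have "\<dots> \<le> \<alpha>\<^sup>2 / 4" by (simp add: \<gamma>_def)
  finally have 2: "energy X D0 D1 (\<lambda>x. real (\<tau> (g x) (a x)) * \<gamma> - 1)
    \<le> energy X D0 D1 (\<lambda>x. h (g x) (a x)) + \<alpha>\<^sup>2 / 4" by simp
  have 3: "energy X D0 D1 (\<lambda>x. posterior D0 D1 (\<lambda>x. \<tau> (g x) (a x)) (\<tau> (g x) (a x)))
      \<le> energy X D0 D1 (\<lambda>x. real (\<tau> (g x) (a x)) * \<gamma> - 1)"
    using energy_posterior_le[OF X, of "\<lambda>x. \<tau> (g x) (a x)" L "\<lambda>c. real c * \<gamma> - 1"] \<tau>_less by simp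
  show ?thesis using 1 2 3 \<tau>_less by (intro exI[of _ \<tau>]) (simp add: f_def)
qed

text \<open>As long as some circuit violates calibration, refining the labels lowers the energy by
  \<open>\<alpha>\<^sup>2 / 4\<close>. It starts at most at 0 and never falls below -1, so at most
  \<open>4 / \<alpha>\<^sup>2\<close> rounds are possible.\<close>

lemma calibrated_labelling_exists:
  assumes X: "set_pmf D0 \<subseteq> bitstrings n" "set_pmf D1 \<subseteq> bitstrings n"
    and \<omega>: "\<And>v. 0 \<le> \<omega> v" "\<And>v. \<omega> v \<le> 1"
    and \<alpha>: "0 < \<alpha>" "\<alpha> \<le> 1" and L: "L = nat \<lfloor>120 / \<alpha>\<^sup>2\<rfloor> + 1"
  obtains T g where "labelling n s L T g" "real T \<le> 4 / \<alpha>\<^sup>2"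
    "\<And>A. A \<in> circuits n s \<Longrightarrow>
       \<bar>calibration_error (bitstrings n) \<omega> D0 D1 g (circuit_eval A)\<bar> \<le> \<alpha>"
proof -
  let ?X = "bitstrings n"
  define good where "good g \<longleftrightarrow> (\<forall>A\<in>circuits n s. \<bar>calibration_error ?X \<omega> D0 D1 g (circuit_eval A)\<bar> \<le> \<alpha>)" for g
  define e where "e g = energy ?X D0 D1 (\<lambda>x. posterior D0 D1 g (g x))" for g
  have "L > 0" by (simp add: L)
  have "(\<exists>T<N. \<exists>g. labelling n s L T g \<and> good g) \<or>
      (\<exists>g. labelling n s L N g \<and> e g \<le> - real N * (\<alpha>\<^sup>2 / 4))" for N
  proof (induction N)
    case 0
    \<comment> \<open>The constant labelling is compared with the zero function, whose energy is
      0.\<close>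
    have "e (\<lambda>_. 0) \<le> energy ?X D0 D1 (\<lambda>x. (\<lambda>_. 0) ((\<lambda>_. 0) x :: nat))"
      unfolding e_def by (rule energy_posterior_le[OF finite_bitstrings X \<open>L > 0\<close>])
    then show ?case by (intro disjI2 exI[of _ "\<lambda>_. 0"]) (simp add: energy_def labelling.start)
  next
    case (Suc N)
    then consider "\<exists>T<N. \<exists>g. labelling n s L T g \<and> good g"
      | g where "labelling n s L N g" "good g"
      | g A where "labelling n s L N g" "e g \<le> - real N * (\<alpha>\<^sup>2 / 4)" "A \<in> circuits n s"
         "\<bar>calibration_error ?X \<omega> D0 D1 g (circuit_eval A)\<bar> > \<alpha>"
      unfolding good_def by (meson not_le)
    then show ?case
    proof cases
      case (3 g A)
      obtain \<tau> where \<tau>: "\<forall>l b. \<tau> l b < L"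
        "e (\<lambda>x. \<tau> (g x) (circuit_eval A x)) \<le> e g - \<alpha>\<^sup>2 / 4"
        using energy_decrement[OF finite_bitstrings X labelling_less[OF 3(1) \<open>L > 0\<close>] \<omega> \<alpha> L 3(4)]
        unfolding e_def by blast
      have "labelling n s L (Suc N) (\<lambda>x. \<tau> (g x) (circuit_eval A x))"
        using \<tau>(1) by (intro labelling.step[OF 3(1,3)]) auto
      with \<tau>(2) 3(2) show ?thesis
        by (intro disjI2 exI[of _ "\<lambda>x. \<tau> (g x) (circuit_eval A x)"]) (simp add: algebra_simps)
    qed (auto simp: less_Suc_eq)
  qed
  from this[of "nat \<lfloor>4 / \<alpha>\<^sup>2\<rfloor> + 1"] show ?thesis
  proof
    assume "\<exists>T<nat \<lfloor>4 / \<alpha>\<^sup>2\<rfloor> + 1. \<exists>g. labelling n s L T g \<and> good g"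
    then obtain T g where T: "T \<le> nat \<lfloor>4 / \<alpha>\<^sup>2\<rfloor>" "labelling n s L T g" "good g"
      by (auto simp: less_Suc_eq_le)
    have "4 / \<alpha>\<^sup>2 \<ge> 0" by simp
    then have "real T \<le> 4 / \<alpha>\<^sup>2" using T(1) by linarith
    with T show ?thesis by (intro that[of T g]) (auto simp: good_def)
  next
    let ?N = "nat \<lfloor>4 / \<alpha>\<^sup>2\<rfloor> + 1"
    assume "\<exists>g. labelling n s L ?N g \<and> e g \<le> - real ?N * (\<alpha>\<^sup>2 / 4)"
    moreover have "real ?N * (\<alpha>\<^sup>2 / 4) > 1"
    proof -
      have "4 / \<alpha>\<^sup>2 < real ?N" by linarith
      then show ?thesis using \<alpha> by (simp add: field_simps)
    qed
    moreover have "e g \<ge> - 1" for g unfolding e_def by (rule energy_ge[OF finite_bitstrings X(2)])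
    ultimately have False by (smt (verit) mult_minus_left)
    then show ?thesis ..
  qed
qed

section \<open>Replacing the distributions\<close>

lemma prob_cong_support:
  assumes "\<And>x. x \<in> set_pmf P \<Longrightarrow> x \<in> S \<longleftrightarrow> x \<in> S'"
  shows "measure_pmf.prob P S = measure_pmf.prob P S'"
  using assms by (intro measure_pmf.finite_measure_eq_AE) (auto simp: AE_measure_pmf_iff)

text \<open>\<open>E0\<close> and \<open>E1\<close> share the conditional distribution \<kappa>
  inside each label class, so their near-optimal test sees only labels. The labels are distributed
  as under \<open>D0\<close> and \<open>D1\<close>, so the test has the same advantage there, and a
  circuit computes it.\<close>

lemma d_TV_k_fold_le_d_circ:
  assumes D: "set_pmf D0 \<subseteq> bitstrings n" "set_pmf D1 \<subseteq> bitstrings n"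
    and E: "set_pmf E0 \<subseteq> bitstrings n" "set_pmf E1 \<subseteq> bitstrings n"
    and lab: "labelling n s L T g" "L > 0"
    and map: "map_pmf g E0 = map_pmf g D0" "map_pmf g E1 = map_pmf g D1"
    and \<kappa>: "\<And>x. x \<in> bitstrings n \<Longrightarrow> \<kappa> x \<ge> 0"
      "\<And>x. x \<in> bitstrings n \<Longrightarrow> pmf E0 x = pmf (map_pmf g D0) (g x) * \<kappa> x"
      "\<And>x. x \<in> bitstrings n \<Longrightarrow> pmf E1 x = pmf (map_pmf g D1) (g x) * \<kappa> x"
    and \<delta>: "0 < \<delta>" "\<delta> \<le> 1/2" and \<gamma>: "\<gamma> > 0" "real k * \<gamma> \<le> 1"
    and N: "N = k * (2 * score_offset \<delta> \<gamma>) + 1"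
    and t: "k * (T * (s + 1 + 2 * L + 2 * L\<^sup>2) + N * L + N * (N * L)) + N \<le> t"
  shows "d_TV (k_fold k E0) (k_fold k E1)
    \<le> d_circ (n * k) t (k_fold k D0) (k_fold k D1) + 4 * real k * \<delta> + 2 * real k * \<gamma>"
proof -
  define w where "w c = score \<delta> \<gamma> (pmf (map_pmf g D0) c) (pmf (map_pmf g D1) c)" for c
  define \<theta> where "\<theta> = k * score_offset \<delta> \<gamma>"
  define S where "S = {xs. \<theta> \<le> (\<Sum>x\<leftarrow>xs. score \<delta> \<gamma> (pmf E0 x) (pmf E1 x))}"
  obtain A where A: "A \<in> circuits (n * k) (k * (T * (s + 1 + 2 * L + 2 * L\<^sup>2) + N * L + N * (N * L)) + N)"
    "\<And>z. z \<in> bitstrings (n * k) \<Longrightarrow> circuit_eval A z \<longleftrightarrow> \<theta> \<le> (\<Sum>i<k. w (g (block n i z)))"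
    by (rule threshold_circuit_exists[OF lab, of w "2 * score_offset \<delta> \<gamma>" N k \<theta>])
      (use N in \<open>auto simp: w_def score_le\<close>)
  have A_t: "A \<in> circuits (n * k) t" using A(1) t by (auto simp: circuits_def)
  have score_eq: "score \<delta> \<gamma> (pmf E0 x) (pmf E1 x) = w (g x)"
    if "x \<in> set_pmf E0 \<union> set_pmf E1" for x
  proof -
    have x: "x \<in> bitstrings n" using that E by auto
    have "\<kappa> x \<noteq> 0" using that \<kappa>(2,3)[OF x] by (auto simp: set_pmf_iff)
    then have "\<kappa> x > 0" using \<kappa>(1)[OF x] by simp
    then show ?thesis unfolding \<kappa>(2,3)[OF x] w_def by (rule score_scale)
  qed
  \<comment> \<open>On the support the scores are functions of the labels; the event is pushed
    forward to label sequences, \<open>E\<close> is exchanged for \<open>D\<close> there, and the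
    event is pulled back to strings and read as acceptance by \<open>A\<close>.\<close>
  have transfer: "measure_pmf.prob (replicate_pmf k E) S = measure_pmf.prob (k_fold k D) {z. circuit_eval A z}"
    if E: "set_pmf E \<subseteq> set_pmf E0 \<union> set_pmf E1" and D: "set_pmf D \<subseteq> bitstrings n"
      and map: "map_pmf g E = map_pmf g D" for D E
  proof -
    let ?S1 = "{xs. \<theta> \<le> (\<Sum>x\<leftarrow>xs. w (g x))}"
    have "measure_pmf.prob (replicate_pmf k E) S = measure_pmf.prob (replicate_pmf k E) ?S1"
    proof (rule prob_cong_support)
      fix xs assume "xs \<in> set_pmf (replicate_pmf k E)"
      then have "map (\<lambda>x. score \<delta> \<gamma> (pmf E0 x) (pmf E1 x)) xs = map (\<lambda>x. w (g x)) xs"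
        using E score_eq by (auto simp: set_replicate_pmf)
      then have "(\<Sum>x\<leftarrow>xs. score \<delta> \<gamma> (pmf E0 x) (pmf E1 x)) = (\<Sum>x\<leftarrow>xs. w (g x))"
        by (rule arg_cong)
      then show "xs \<in> S \<longleftrightarrow> xs \<in> ?S1" by (simp only: S_def mem_Collect_eq)
    qed
    also have "\<dots> = measure_pmf.prob (map_pmf (map g) (replicate_pmf k E)) {cs. \<theta> \<le> (\<Sum>c\<leftarrow>cs. w c)}"
      by (simp add: vimage_def comp_def)
    also have "\<dots> = measure_pmf.prob (map_pmf (map g) (replicate_pmf k D)) {cs. \<theta> \<le> (\<Sum>c\<leftarrow>cs. w c)}"
      by (simp only: map_replicate_pmf map)
    also have "\<dots> = measure_pmf.prob (replicate_pmf k D) ?S1"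
      by (simp add: vimage_def comp_def)
    also have "\<dots> = measure_pmf.prob (replicate_pmf k D) {xs. concat xs \<in> {z. circuit_eval A z}}"
    proof (rule prob_cong_support)
      fix xs assume "xs \<in> set_pmf (replicate_pmf k D)"
      then have xs: "length xs = k" "\<And>x. x \<in> set xs \<Longrightarrow> length x = n"
        using D by (auto simp: set_replicate_pmf bitstrings_def)
      have "(\<Sum>i<k. w (g (block n i (concat xs)))) = (\<Sum>i<k. w (g (xs ! i)))"
        using xs by (intro sum.cong) (simp_all add: block_concat)
      also have "\<dots> = (\<Sum>x\<leftarrow>xs. w (g x))"
        using xs(1) by (simp add: sum_list_sum_nth atLeast0LessThan)
      finally have "(\<Sum>i<k. w (g (block n i (concat xs)))) = (\<Sum>x\<leftarrow>xs. w (g x))" .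
      moreover have "concat xs \<in> bitstrings (n * k)"
        using length_concat_uniform[OF xs(2)] xs(1) by (simp add: bitstrings_def)
      ultimately show "xs \<in> ?S1 \<longleftrightarrow> xs \<in> {xs. concat xs \<in> {z. circuit_eval A z}}"
        using A(2) by simp
    qed
    also have "\<dots> = measure_pmf.prob (k_fold k D) {z. circuit_eval A z}" by (simp add: prob_k_fold)
    finally show ?thesis .
  qed
  have fin: "finite (set_pmf E0)" "finite (set_pmf E1)"
    using E finite_bitstrings finite_subset by blast+
  show ?thesis
  proof (rule d_TV_leI)
    fix S'
    have "measure_pmf.prob (k_fold k E1) S' - measure_pmf.prob (k_fold k E0) S'
      \<le> measure_pmf.prob (replicate_pmf k E1) S - measure_pmf.prob (replicate_pmf k E0) S
        + 4 * real k * \<delta> + 2 * real k * \<gamma>"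
      unfolding prob_k_fold S_def \<theta>_def by (rule sum_score_test[OF fin \<delta> \<gamma>])
    also have "measure_pmf.prob (replicate_pmf k E1) S - measure_pmf.prob (replicate_pmf k E0) S
        \<le> advantage A (k_fold k D0) (k_fold k D1)"
      unfolding advantage_eq_prob
      using transfer[OF _ D(1) map(1)] transfer[OF _ D(2) map(2)] by auto
    also have "\<dots> \<le> d_circ (n * k) t (k_fold k D0) (k_fold k D1)"
      using A_t by (rule advantage_le_d_circ)
    finally show "measure_pmf.prob (k_fold k E1) S' - measure_pmf.prob (k_fold k E0) S'
      \<le> d_circ (n * k) t (k_fold k D0) (k_fold k D1) + 4 * real k * \<delta> + 2 * real k * \<gamma>"
      by simp
  qed
qed

section \<open>Distributions with prescribed labels and conditionals\<close>

lemma pmf_map_eq_sum: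
  assumes "finite X" "set_pmf D \<subseteq> X"
  shows "pmf (map_pmf g D) c = (\<Sum>x | x \<in> X \<and> g x = c. pmf D x)"
proof -
  have "pmf (map_pmf g D) c = (\<Sum>x\<in>X. pmf D x * indicator (g -` {c}) x)"
    by (simp add: pmf_map prob_finite_support[OF assms])
  also have "\<dots> = (\<Sum>x | x \<in> X \<and> g x = c. pmf D x)"
    using assms(1) by (simp add: indicator_def if_distrib sum.If_cases Int_def cong: if_cong)
  finally show ?thesis .
qed

lemma pmf_le_pmf_map: "pmf D x \<le> pmf (map_pmf g D) (g x)"
proof -
  have "pmf D x = measure_pmf.prob D {x}" by (simp add: measure_pmf_single)
  also have "\<dots> \<le> measure_pmf.prob D (g -` {g x})" by (intro measure_pmf.finite_measure_mono) auto
  finally show ?thesis by (simp add: pmf_map)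
qed

text \<open>\<kappa> is a conditional distribution inside each fibre of \<open>g\<close>. It is
  normalised on labels of positive mass; on a null fibre it may vanish, as a quotient by 0
  does.\<close>

lemma pmf_with_conditionals_exists:
  fixes P :: "'b pmf" and \<kappa> :: "'a \<Rightarrow> real"
  assumes "finite X" and nonneg: "\<And>x. x \<in> X \<Longrightarrow> \<kappa> x \<ge> 0"
    and one: "\<And>c. c \<in> set_pmf P \<Longrightarrow> (\<Sum>x | x \<in> X \<and> g x = c. \<kappa> x) = 1"
  obtains E where "set_pmf E \<subseteq> X" "map_pmf g E = P" "\<And>x. x \<in> X \<Longrightarrow> pmf E x = pmf P (g x) * \<kappa> x"
proof -
  define f where "f x = (if x \<in> X then pmf P (g x) * \<kappa> x else 0)" for x
  have f: "f x \<ge> 0" for x using nonneg by (simp add: f_def)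
  have fibre: "(\<Sum>x | x \<in> X \<and> g x = c. f x) = pmf P c" for c
  proof -
    have "(\<Sum>x | x \<in> X \<and> g x = c. f x) = pmf P c * (\<Sum>x | x \<in> X \<and> g x = c. \<kappa> x)"
      unfolding sum_distrib_left by (intro sum.cong) (auto simp: f_def)
    then show ?thesis using one[of c] by (cases "c \<in> set_pmf P") (auto simp: set_pmf_iff)
  qed
  have "set_pmf P \<subseteq> g ` X"
  proof
    fix c assume "c \<in> set_pmf P"
    from one[OF this] have "{x. x \<in> X \<and> g x = c} \<noteq> {}" by (metis sum.empty zero_neq_one)
    then show "c \<in> g ` X" by auto
  qed
  then have "(\<Sum>c\<in>g ` X. pmf P c) = 1"
    using \<open>finite X\<close> by (intro sum_pmf_finite_support) auto
  then have sum: "(\<Sum>x\<in>X. f x) = 1"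
    using sum.image_gen[OF \<open>finite X\<close>, of f g] by (simp add: fibre)
  have "(\<integral>\<^sup>+x. ennreal (f x) \<partial>count_space UNIV) = (\<Sum>x\<in>X. ennreal (f x))"
    using \<open>finite X\<close> by (intro nn_integral_count_space') (auto simp: f_def)
  also have "\<dots> = 1" using f by (simp add: sum_ennreal sum)
  finally have int: "(\<integral>\<^sup>+x. ennreal (f x) \<partial>count_space UNIV) = 1" .
  define E where "E = embed_pmf f"
  have pmf_E: "pmf E x = f x" for x unfolding E_def by (rule pmf_embed_pmf[OF f int])
  have set_E: "set_pmf E \<subseteq> X" by (auto simp: set_pmf_iff pmf_E f_def split: if_splits)
  show ?thesis
  proof (rule that[OF set_E])
    show "map_pmf g E = P"
      by (rule pmf_eqI) (simp add: pmf_map_eq_sum[OF \<open>finite X\<close> set_E] pmf_E fibre)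
  qed (simp add: pmf_E f_def)
qed

section \<open>Circuit size\<close>

lemma size_bound:
  fixes \<epsilon> a :: real
  assumes k: "k \<ge> 1" and \<epsilon>: "0 < \<epsilon>" "\<epsilon> \<le> 1" "real k / \<epsilon> \<ge> 2"
    and T: "real T \<le> a" "a \<le> 1024 / \<epsilon> ^ 4" and L: "real L \<le> 30721 / \<epsilon> ^ 4"
    and N: "real N \<le> 515 * (real k / \<epsilon>\<^sup>2)"
  shows "real (k * (T * (s + 1 + 2 * L + 2 * L\<^sup>2) + N * L + N * (N * L)) + N)
    \<le> real k * a * real s + (real k / \<epsilon>) powr 1024"
proof -
  \<comment> \<open>Both \<open>k\<close> and \<open>1 / \<epsilon>\<close> are at most
    \<open>y\<close>, so every term without \<open>s\<close> becomes a multiple of a power of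
    \<open>y\<close>, the highest being \<open>y ^ 13\<close> from \<open>k * T * L\<^sup>2\<close>.
    Only the term with \<open>s\<close> keeps the exact bound \<open>a\<close> on the
    rounds.\<close>
  define y where "y = real k / \<epsilon>"
  have y: "y \<ge> 2" "y > 0" using \<epsilon> by (auto simp: y_def)
  have ky: "real k \<le> y" using k \<epsilon> by (simp add: y_def le_divide_eq mult_left_le)
  have ey: "1 / \<epsilon> \<le> y" using k \<epsilon> by (simp add: y_def divide_right_mono)
  then have pow: "1 / \<epsilon> ^ i \<le> y ^ i" for i
    using power_mono[OF ey, of i] \<epsilon> by (simp add: power_one_over)
  have T': "real T \<le> 1024 * y ^ 4" using T pow[of 4] by simp
  have L': "real L \<le> 30721 * y ^ 4" using L pow[of 4] by simp
  have "real k * (1 / \<epsilon>\<^sup>2) \<le> y * y\<^sup>2" using pow[of 2] ky y by (intro mult_mono) auto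
  then have N': "real N \<le> 515 * y ^ 3" using N by (simp add: power3_eq_cube power2_eq_square)
  define l where "l = 30721 * y ^ 4"
  have "y ^ 4 \<ge> 1" using y by simp
  then have l1: "l \<ge> 1" by (simp add: l_def)
  have "1 + 2 * real L + 2 * (real L)\<^sup>2 \<le> 1 + 2 * l + 2 * l\<^sup>2"
    using L' by (intro add_mono mult_left_mono power_mono) (auto simp: l_def)
  also have "\<dots> \<le> 5 * l\<^sup>2"
  proof -
    have "l \<le> l * l" using l1 mult_left_mono[of 1 l l] by linarith
    with l1 show ?thesis unfolding power2_eq_square by linarith
  qed
  finally have q: "1 + 2 * real L + 2 * (real L)\<^sup>2 \<le> 5 * l\<^sup>2" .
  have 1: "real k * (real T * (1 + 2 * real L + 2 * (real L)\<^sup>2)) \<le> y * ((1024 * y ^ 4) * (5 * l\<^sup>2))"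
    using ky T' q y by (intro mult_mono) auto
  have 2: "real k * (real N * real L) \<le> y * ((515 * y ^ 3) * l)"
    using ky N' L' y by (intro mult_mono) (auto simp: l_def)
  have 3: "real k * (real N * (real N * real L)) \<le> y * ((515 * y ^ 3) * ((515 * y ^ 3) * l))"
    using ky N' L' y by (intro mult_mono) (auto simp: l_def)
  have le: "y ^ i \<le> y ^ 13" if "i \<le> 13" for i using that y by (intro power_increasing) auto
  have "y * ((1024 * y ^ 4) * (5 * l\<^sup>2)) + y * ((515 * y ^ 3) * l)
      + y * ((515 * y ^ 3) * ((515 * y ^ 3) * l)) + 515 * y ^ 3
    = 4832152785920 * y ^ 13 + 15821315 * y ^ 8 + 8147977225 * y ^ 11 + 515 * y ^ 3"
    unfolding l_def by (simp add: power2_eq_square power_numeral_reduce algebra_simps)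
  \<comment> \<open>The coefficients add up to less than \<open>2 ^ 43\<close>, and
    \<open>y \<ge> 2\<close> absorbs this constant into the power.\<close>
  also have "\<dots> \<le> 2 ^ 43 * y ^ 13"
  proof -
    have "y ^ 8 \<le> y ^ 13" "y ^ 11 \<le> y ^ 13" "y ^ 3 \<le> y ^ 13" "0 < y ^ 13"
      using y by (auto intro!: le simp del: power_increasing_iff)
    moreover have "(2::real) ^ 43 = 8796093022208" by simp
    ultimately show ?thesis by (simp only:)
  qed
  also have "\<dots> \<le> y ^ 43 * y ^ 13" using y by (intro mult_right_mono power_mono) auto
  also have "\<dots> = y ^ 56" by (simp flip: power_add)
  also have "\<dots> = y powr 56" using y by simp
  also have "\<dots> \<le> y powr 1024" using y by (intro powr_mono) auto
  finally have poly: "y * ((1024 * y ^ 4) * (5 * l\<^sup>2)) + y * ((515 * y ^ 3) * l)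
      + y * ((515 * y ^ 3) * ((515 * y ^ 3) * l)) + 515 * y ^ 3 \<le> y powr 1024" .
  have main: "real k * real T * real s \<le> real k * a * real s"
    using T by (intro mult_right_mono mult_left_mono) auto
  have "real (k * (T * (s + 1 + 2 * L + 2 * L\<^sup>2) + N * L + N * (N * L)) + N) =
    real k * real T * real s + (real k * (real T * (1 + 2 * real L + 2 * (real L)\<^sup>2))
      + real k * (real N * real L) + real k * (real N * (real N * real L)) + real N)"
    by (simp add: algebra_simps)
  also have "\<dots> \<le> real k * a * real s + y powr 1024"
    using main 1 2 3 N' poly by linarith
  finally show ?thesis by (simp add: y_def)
qed


section \<open>The two constructions\<close>

lemma advantage_eq_sum:
  assumes "set_pmf P \<subseteq> bitstrings n" "set_pmf Q \<subseteq> bitstrings n"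
  shows "advantage A P Q = \<bar>\<Sum>x\<in>bitstrings n. (pmf Q x - pmf P x) * of_bool (circuit_eval A x)\<bar>"
proof -
  have "(\<Sum>x\<in>bitstrings n. (pmf Q x - pmf P x) * of_bool (circuit_eval A x)) =
    (\<Sum>x\<in>bitstrings n. pmf Q x * of_bool (circuit_eval A x)) -
    (\<Sum>x\<in>bitstrings n. pmf P x * of_bool (circuit_eval A x))"
    by (simp only: sum_subtractf[symmetric] left_diff_distrib)
  then show ?thesis
    unfolding advantage_def expectation_finite_support[OF finite_bitstrings assms(1)]
      expectation_finite_support[OF finite_bitstrings assms(2)] by linarith
qed

text \<open>The test is run with smoothing \<open>\<epsilon> / 16\<close> and rounding
  \<open>\<epsilon> / 8\<close>, which makes its loss \<open>4 * k * \<epsilon> / 16 + 2 * k *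
  \<epsilon> / 8 = k * \<epsilon> / 2\<close>. The exponent \<open>e\<close> is 2 for the first
  claim and 4 for the second.\<close>

lemma d_TV_k_fold_le_d_circ_size:
  fixes \<epsilon> :: real
  assumes D: "set_pmf D0 \<subseteq> bitstrings n" "set_pmf D1 \<subseteq> bitstrings n"
    and E: "set_pmf E0 \<subseteq> bitstrings n" "set_pmf E1 \<subseteq> bitstrings n"
    and lab: "labelling n s L T g" "L > 0"
    and map: "map_pmf g E0 = map_pmf g D0" "map_pmf g E1 = map_pmf g D1"
    and \<kappa>: "\<And>x. x \<in> bitstrings n \<Longrightarrow> \<kappa> x \<ge> 0"
      "\<And>x. x \<in> bitstrings n \<Longrightarrow> pmf E0 x = pmf (map_pmf g D0) (g x) * \<kappa> x"
      "\<And>x. x \<in> bitstrings n \<Longrightarrow> pmf E1 x = pmf (map_pmf g D1) (g x) * \<kappa> x"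
    and k: "k \<ge> 1" and \<epsilon>: "0 < \<epsilon>" "real k * \<epsilon> \<le> 1" "real k / \<epsilon> \<ge> 2"
    and T: "real T \<le> 1024 / \<epsilon> ^ e" "e \<le> 4" and L: "real L \<le> 30721 / \<epsilon> ^ 4"
  shows "d_TV (k_fold k E0) (k_fold k E1)
    \<le> d_circ (n * k) (nat \<lceil>1024 * real s * real k / \<epsilon> ^ e + (real k / \<epsilon>) powr 1024\<rceil>)
        (k_fold k D0) (k_fold k D1) + real k * \<epsilon> / 2"
proof -
  have \<epsilon>1: "\<epsilon> \<le> 1" using order.trans[OF mult_right_mono[of 1 "real k" \<epsilon>] \<epsilon>(2)] k \<epsilon>(1) by simp
  \<comment> \<open>The offset is at most \<open>256 / \<epsilon>\<^sup>2 + 1\<close>, hence at most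
    \<open>257 / \<epsilon>\<^sup>2\<close>; doubling it, multiplying by \<open>k\<close> and adding
    1 gives the factor 515.\<close>
  define N where "N = k * (2 * score_offset (\<epsilon> / 16) (\<epsilon> / 8)) + 1"
  have inv: "1 \<le> 1 / \<epsilon>\<^sup>2" using \<epsilon>(1) \<epsilon>1 power_le_one[of \<epsilon> 2] by simp
  have "real (score_offset (\<epsilon> / 16) (\<epsilon> / 8)) \<le> 2 / (\<epsilon> / 16 * (\<epsilon> / 8)) + 1"
    using \<epsilon>(1) \<epsilon>1 by (intro score_offset_le) auto
  also have "2 / (\<epsilon> / 16 * (\<epsilon> / 8)) = 256 * (1 / \<epsilon>\<^sup>2)" by (simp add: power2_eq_square)
  finally have "real (score_offset (\<epsilon> / 16) (\<epsilon> / 8)) \<le> 257 * (1 / \<epsilon>\<^sup>2)" using inv by linarith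
  then have "real k * (2 * real (score_offset (\<epsilon> / 16) (\<epsilon> / 8))) \<le> real k * (2 * (257 * (1 / \<epsilon>\<^sup>2)))"
    by (intro mult_left_mono) auto
  moreover have "1 * 1 \<le> real k * (1 / \<epsilon>\<^sup>2)" using k inv by (intro mult_mono) auto
  ultimately have N: "real N \<le> 515 * (real k / \<epsilon>\<^sup>2)" by (simp add: N_def)
  have "1024 / \<epsilon> ^ e \<le> 1024 / \<epsilon> ^ 4"
    using \<epsilon>(1) \<epsilon>1 T(2) by (intro divide_left_mono power_decreasing) auto
  note size = size_bound[OF k \<epsilon>(1) \<epsilon>1 \<epsilon>(3) T(1) this L N, of s]
  have nat_ceilingI: "m \<le> nat \<lceil>x\<rceil>" if "real m \<le> x" for m and x :: real using that by linarith
  have "real k * (1024 / \<epsilon> ^ e) * real s = 1024 * real s * real k / \<epsilon> ^ e" by simp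
  with size have "k * (T * (s + 1 + 2 * L + 2 * L\<^sup>2) + N * L + N * (N * L)) + N
    \<le> nat \<lceil>1024 * real s * real k / \<epsilon> ^ e + (real k / \<epsilon>) powr 1024\<rceil>"
    by (intro nat_ceilingI) (simp only:)
  from d_TV_k_fold_le_d_circ[OF D E lab map \<kappa> _ _ _ _ N_def this]
  show ?thesis using \<epsilon> \<epsilon>1 by (simp add: algebra_simps)
qed

text \<open>Inside each label class both new distributions follow \<mu>. Then \<open>E1\<close> is
  \<mu> times the posterior and \<open>E0 + E1 = \<mu>\<close>, so \<open>E1 - D1\<close> and
  \<open>D0 - E0\<close> are both the residual, and the calibration error with weight 1 is the
  signed advantage. Each side gets \<open>\<epsilon> / 2\<close> because the lower bound adds the
  two errors.\<close>

lemma indistinguishable_pair_exists: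
  fixes \<epsilon> :: real
  assumes D: "set_pmf D0 \<subseteq> bitstrings n" "set_pmf D1 \<subseteq> bitstrings n"
    and k: "k \<ge> 1" and \<epsilon>: "0 < \<epsilon>" "real k * \<epsilon> \<le> 1" "real k / \<epsilon> \<ge> 2"
  obtains E0 E1 where "set_pmf E0 \<subseteq> bitstrings n" "set_pmf E1 \<subseteq> bitstrings n"
    "d_circ n s D0 E0 \<le> \<epsilon> / 2" "d_circ n s D1 E1 \<le> \<epsilon> / 2"
    "d_TV (k_fold k E0) (k_fold k E1)
      \<le> d_circ (n * k) (nat \<lceil>1024 * real s * real k / \<epsilon> ^ 2 + (real k / \<epsilon>) powr 1024\<rceil>)
          (k_fold k D0) (k_fold k D1) + real k * \<epsilon> / 2"
proof -
  let ?X = "bitstrings n"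
  have \<epsilon>1: "\<epsilon> \<le> 1" using order.trans[OF mult_right_mono[of 1 "real k" \<epsilon>] \<epsilon>(2)] k \<epsilon>(1) by simp
  define \<alpha> where "\<alpha> = \<epsilon> / 2"
  have \<alpha>: "0 < \<alpha>" "\<alpha> \<le> 1" using \<epsilon> \<epsilon>1 by (auto simp: \<alpha>_def)
  define L where "L = nat \<lfloor>120 / \<alpha>\<^sup>2\<rfloor> + 1"
  obtain T g where lab: "labelling n s L T g" and T: "real T \<le> 4 / \<alpha>\<^sup>2"
    and cal: "\<And>A. A \<in> circuits n s \<Longrightarrow>
       \<bar>calibration_error ?X (\<lambda>_. 1) D0 D1 g (circuit_eval A)\<bar> \<le> \<alpha>"
    by (rule calibrated_labelling_exists[OF D, of "\<lambda>_. 1" \<alpha> L s]) (use \<alpha> L_def in auto)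
  define p where "p c = pmf (map_pmf g D0) c" for c
  define q where "q c = pmf (map_pmf g D1) c" for c
  define \<kappa> where "\<kappa> x = (pmf D0 x + pmf D1 x) / (p (g x) + q (g x))" for x
  have \<kappa>_nonneg: "\<kappa> x \<ge> 0" for x by (simp add: \<kappa>_def p_def q_def)
  have nonneg: "p c \<ge> 0" "q c \<ge> 0" for c by (simp_all add: p_def q_def)
  have \<kappa>_sum: "(\<Sum>x | x \<in> ?X \<and> g x = c. \<kappa> x) = 1" if "p c + q c \<noteq> 0" for c
  proof -
    have "(\<Sum>x | x \<in> ?X \<and> g x = c. \<kappa> x) =
      (\<Sum>x | x \<in> ?X \<and> g x = c. pmf D0 x + pmf D1 x) / (p c + q c)"
      unfolding sum_divide_distrib by (intro sum.cong) (auto simp: \<kappa>_def)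
    also have "(\<Sum>x | x \<in> ?X \<and> g x = c. pmf D0 x + pmf D1 x) = p c + q c"
      by (simp add: sum.distrib p_def q_def pmf_map_eq_sum[OF finite_bitstrings D(1)]
          pmf_map_eq_sum[OF finite_bitstrings D(2)])
    finally show ?thesis using that by simp
  qed
  have supp: "p c + q c \<noteq> 0" if "c \<in> set_pmf (map_pmf g D0) \<or> c \<in> set_pmf (map_pmf g D1)" for c
  proof -
    have "p c > 0 \<or> q c > 0" using that unfolding p_def q_def pmf_positive_iff .
    then show ?thesis using nonneg[of c] by linarith
  qed
  obtain E0 where E0: "set_pmf E0 \<subseteq> ?X" "map_pmf g E0 = map_pmf g D0"
    "\<And>x. x \<in> ?X \<Longrightarrow> pmf E0 x = pmf (map_pmf g D0) (g x) * \<kappa> x"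
    by (rule pmf_with_conditionals_exists[OF finite_bitstrings \<kappa>_nonneg \<kappa>_sum[OF supp], of "map_pmf g D0"])
      auto
  obtain E1 where E1: "set_pmf E1 \<subseteq> ?X" "map_pmf g E1 = map_pmf g D1"
    "\<And>x. x \<in> ?X \<Longrightarrow> pmf E1 x = pmf (map_pmf g D1) (g x) * \<kappa> x"
    by (rule pmf_with_conditionals_exists[OF finite_bitstrings \<kappa>_nonneg \<kappa>_sum[OF supp], of "map_pmf g D1"])
      auto
  have diff: "pmf E1 x - pmf D1 x =
      (pmf D0 x + pmf D1 x) * posterior D0 D1 g (g x) - pmf D1 x"
      "- (pmf E0 x - pmf D0 x) =
      (pmf D0 x + pmf D1 x) * posterior D0 D1 g (g x) - pmf D1 x" if "x \<in> ?X" for x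
  proof -
    have "p (g x) * \<kappa> x + q (g x) * \<kappa> x = pmf D0 x + pmf D1 x"
    proof (cases "p (g x) + q (g x) = 0")
      case True
      then have "p (g x) = 0" "q (g x) = 0" using nonneg[of "g x"] by linarith+
      then have "pmf D0 x = 0" "pmf D1 x = 0"
        using pmf_le_pmf_map[of D0 x g] pmf_le_pmf_map[of D1 x g] by (auto simp: p_def q_def antisym)
      then show ?thesis by (simp add: \<kappa>_def)
    next
      case False
      have "p (g x) * \<kappa> x + q (g x) * \<kappa> x = (p (g x) + q (g x)) * \<kappa> x"
        by (rule distrib_right[symmetric])
      also have "\<dots> = pmf D0 x + pmf D1 x" using False by (simp add: \<kappa>_def)
      finally show ?thesis .
    qed
    moreover have "q (g x) * \<kappa> x = (pmf D0 x + pmf D1 x) * posterior D0 D1 g (g x)"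
      by (simp add: \<kappa>_def posterior_def p_def q_def)
    ultimately show "pmf E1 x - pmf D1 x =
      (pmf D0 x + pmf D1 x) * posterior D0 D1 g (g x) - pmf D1 x"
      "- (pmf E0 x - pmf D0 x) =
      (pmf D0 x + pmf D1 x) * posterior D0 D1 g (g x) - pmf D1 x"
      using E0(3)[OF that] E1(3)[OF that] unfolding p_def q_def by linarith+
  qed
  have adv: "advantage A D1 E1 \<le> \<epsilon> / 2" "advantage A D0 E0 \<le> \<epsilon> / 2" if "A \<in> circuits n s" for A
  proof -
    have "(\<Sum>x\<in>?X. (pmf E1 x - pmf D1 x) * of_bool (circuit_eval A x)) =
      calibration_error ?X (\<lambda>_. 1) D0 D1 g (circuit_eval A)"
      unfolding calibration_error_def using diff(1) by (intro sum.cong) auto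
    then show "advantage A D1 E1 \<le> \<epsilon> / 2"
      using cal[OF that] by (simp add: advantage_eq_sum[OF D(2) E1(1)] \<alpha>_def)
    have "- (\<Sum>x\<in>?X. (pmf E0 x - pmf D0 x) * of_bool (circuit_eval A x)) =
      calibration_error ?X (\<lambda>_. 1) D0 D1 g (circuit_eval A)"
      unfolding calibration_error_def sum_negf[symmetric] mult_minus_left[symmetric]
      using diff(2) by (intro sum.cong) auto
    then show "advantage A D0 E0 \<le> \<epsilon> / 2"
      using cal[OF that] unfolding advantage_eq_sum[OF D(1) E0(1)] \<alpha>_def by linarith
  qed
  have inv: "1 \<le> 1 / \<epsilon> ^ 4" using \<epsilon>(1) \<epsilon>1 power_le_one[of \<epsilon> 4] by simp
  have inv2: "1 / \<epsilon>\<^sup>2 \<le> 1 / \<epsilon> ^ 4" using \<epsilon>(1) \<epsilon>1 by (intro divide_left_mono power_decreasing) auto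
  have T': "real T \<le> 1024 / \<epsilon>\<^sup>2"
  proof -
    have "real T \<le> 16 / \<epsilon>\<^sup>2" using T by (simp add: \<alpha>_def power_divide)
    also have "\<dots> \<le> 1024 / \<epsilon>\<^sup>2" by (simp add: divide_right_mono)
    finally show ?thesis .
  qed
  have L': "real L \<le> 30721 / \<epsilon> ^ 4"
  proof -
    have "120 / \<alpha>\<^sup>2 \<ge> 0" by simp
    then have "real L \<le> 120 / \<alpha>\<^sup>2 + 1" unfolding L_def by linarith
    also have "120 / \<alpha>\<^sup>2 = 480 * (1 / \<epsilon>\<^sup>2)" by (simp add: \<alpha>_def power_divide)
    finally have "real L \<le> 30721 * (1 / \<epsilon> ^ 4)" using inv inv2 by linarith
    then show ?thesis by simp
  qed
  have "L > 0" by (simp add: L_def)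
  show ?thesis
    by (rule that[OF E0(1) E1(1) d_circ_leI d_circ_leI]; (rule adv | rule
      d_TV_k_fold_le_d_circ_size[OF D E0(1) E1(1) lab \<open>L > 0\<close> E0(2) E1(2) \<kappa>_nonneg E0(3) E1(3) k \<epsilon> T' _ L'])?)
      auto
qed

text \<open>The auxiliary \<open>E0\<close> agrees with \<open>D0\<close> on good labels, and
  \<open>E1\<close> agrees with \<open>D1\<close> on bad ones. Bad labels have mass at most
  \<open>2 * \<delta>\<close> under \<open>E0\<close> and \<open>D0\<close>, so exchanging
  \<open>E0\<close> for \<open>D0\<close> in the product costs at most
  \<open>4 * k * \<delta> = k * \<epsilon> / 4\<close>.\<close>

lemma indistinguishable_single_exists:
  fixes \<epsilon> :: real
  assumes D: "set_pmf D0 \<subseteq> bitstrings n" "set_pmf D1 \<subseteq> bitstrings n"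
    and k: "k \<ge> 1" and \<epsilon>: "0 < \<epsilon>" "real k * \<epsilon> \<le> 1" "real k / \<epsilon> \<ge> 2"
  obtains E1 where "set_pmf E1 \<subseteq> bitstrings n" "d_circ n s D1 E1 \<le> \<epsilon>"
    "d_TV (k_fold k D0) (k_fold k E1)
      \<le> d_circ (n * k) (nat \<lceil>1024 * real s * real k / \<epsilon> ^ 4 + (real k / \<epsilon>) powr 1024\<rceil>)
          (k_fold k D0) (k_fold k D1) + real k * \<epsilon>"
proof -
  let ?X = "bitstrings n"
  have \<epsilon>1: "\<epsilon> \<le> 1" using order.trans[OF mult_right_mono[of 1 "real k" \<epsilon>] \<epsilon>(2)] k \<epsilon>(1) by simp
  define \<delta> where "\<delta> = \<epsilon> / 16"
  \<comment> \<open>The weight \<open>1 / (1 - v)\<close> is scaled by \<delta> to stay at most 1,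
    so the advantage is the absolute calibration error divided by \<delta>.\<close>
  define \<alpha> where "\<alpha> = \<delta> * \<epsilon>"
  \<comment> \<open>On a label of masses \<open>p\<close>, \<open>q\<close> and posterior \<open>v = q / (p + q)\<close> one has
    \<open>D0 * q / p - D1 = (\<mu> * v - D1) / (1 - v)\<close>.\<close>
  define \<omega> where "\<omega> v = (if \<delta> \<le> 1 - v then \<delta> / (1 - v) else 0)" for v
  have \<delta>: "0 < \<delta>" "\<delta> < 1" using \<epsilon> \<epsilon>1 by (auto simp: \<delta>_def)
  have \<alpha>: "0 < \<alpha>" "\<alpha> \<le> 1" using \<epsilon> \<epsilon>1 \<delta> mult_le_one[of \<delta> \<epsilon>] by (auto simp: \<alpha>_def)
  have \<omega>: "0 \<le> \<omega> v" "\<omega> v \<le> 1" for v using \<delta> by (auto simp: \<omega>_def)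
  define L where "L = nat \<lfloor>120 / \<alpha>\<^sup>2\<rfloor> + 1"
  obtain T g where lab: "labelling n s L T g" and T: "real T \<le> 4 / \<alpha>\<^sup>2"
    and cal: "\<And>A. A \<in> circuits n s \<Longrightarrow>
       \<bar>calibration_error ?X \<omega> D0 D1 g (circuit_eval A)\<bar> \<le> \<alpha>"
    using calibrated_labelling_exists[of D0 n D1 \<omega> \<alpha> L s, OF D \<omega> \<alpha> L_def] by blast
  have "L > 0" by (simp add: L_def)
  have g_less: "g x < L" for x using lab \<open>L > 0\<close> by (rule labelling_less)
  define p where "p c = pmf (map_pmf g D0) c" for c
  define q where "q c = pmf (map_pmf g D1) c" for c
  \<comment> \<open>For \<open>p c + q c > 0\<close> this says that 1 minus the posterior is at
    least \<delta>. Without the division, null labels count as good.\<close>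
  define good where "good c \<longleftrightarrow> \<delta> * (p c + q c) \<le> p c" for c
  define \<kappa> where "\<kappa> x = (if good (g x) then pmf D0 x / p (g x) else pmf D1 x / q (g x))" for x
  have nonneg: "p c \<ge> 0" "q c \<ge> 0" for c by (simp_all add: p_def q_def)
  have \<kappa>_nonneg: "\<kappa> x \<ge> 0" for x by (simp add: \<kappa>_def p_def q_def)
  have good_pos: "p c > 0" if "good c" "p c + q c \<noteq> 0" for c
  proof -
    have "0 < \<delta> * (p c + q c)" using \<delta> that nonneg[of c] by (intro mult_pos_pos) auto
    then show ?thesis using that by (simp add: good_def)
  qed
  have bad_pos: "q c > 0" if "\<not> good c" for c
  proof (rule ccontr)
    assume "\<not> q c > 0"
    then have "q c = 0" using nonneg[of c] by simp
    then have "\<delta> * (p c + q c) \<le> 1 * p c" using \<delta> nonneg[of c] by (simp add: mult_left_le_one_le)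
    then show False using that by (simp add: good_def)
  qed
  have \<kappa>_sum: "(\<Sum>x | x \<in> ?X \<and> g x = c. \<kappa> x) = 1" if "p c + q c \<noteq> 0" for c
  proof (cases "good c")
    case True
    then have "(\<Sum>x | x \<in> ?X \<and> g x = c. \<kappa> x) = (\<Sum>x | x \<in> ?X \<and> g x = c. pmf D0 x) / p c"
      unfolding sum_divide_distrib by (intro sum.cong) (auto simp: \<kappa>_def)
    then show ?thesis
      using good_pos[OF True that] by (simp add: p_def pmf_map_eq_sum[OF finite_bitstrings D(1)])
  next
    case False
    then have "(\<Sum>x | x \<in> ?X \<and> g x = c. \<kappa> x) = (\<Sum>x | x \<in> ?X \<and> g x = c. pmf D1 x) / q c"
      unfolding sum_divide_distrib by (intro sum.cong) (auto simp: \<kappa>_def)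
    then show ?thesis
      using bad_pos[OF False] by (simp add: q_def pmf_map_eq_sum[OF finite_bitstrings D(2)])
  qed
  have supp: "p c + q c \<noteq> 0" if "c \<in> set_pmf (map_pmf g D0) \<or> c \<in> set_pmf (map_pmf g D1)" for c
  proof -
    have "p c > 0 \<or> q c > 0" using that unfolding p_def q_def pmf_positive_iff .
    then show ?thesis using nonneg[of c] by linarith
  qed
  obtain E0 where E0: "set_pmf E0 \<subseteq> ?X" "map_pmf g E0 = map_pmf g D0"
    "\<And>x. x \<in> ?X \<Longrightarrow> pmf E0 x = pmf (map_pmf g D0) (g x) * \<kappa> x"
    by (rule pmf_with_conditionals_exists[OF finite_bitstrings \<kappa>_nonneg \<kappa>_sum[OF supp], of "map_pmf g D0"])
      auto
  obtain E1 where E1: "set_pmf E1 \<subseteq> ?X" "map_pmf g E1 = map_pmf g D1"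
    "\<And>x. x \<in> ?X \<Longrightarrow> pmf E1 x = pmf (map_pmf g D1) (g x) * \<kappa> x"
    by (rule pmf_with_conditionals_exists[OF finite_bitstrings \<kappa>_nonneg \<kappa>_sum[OF supp], of "map_pmf g D1"])
      auto
  have zero: "pmf D0 x = 0" "pmf D1 x = 0" if "p (g x) + q (g x) = 0" for x
  proof -
    have "p (g x) = 0" "q (g x) = 0" using that nonneg[of "g x"] by linarith+
    then show "pmf D0 x = 0" "pmf D1 x = 0"
      using pmf_le_pmf_map[of D0 x g] pmf_le_pmf_map[of D1 x g] by (auto simp: p_def q_def antisym)
  qed
  have diff: "\<delta> * (pmf E1 x - pmf D1 x) =
      ((pmf D0 x + pmf D1 x) * posterior D0 D1 g (g x) - pmf D1 x) * \<omega> (posterior D0 D1 g (g x))"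
    if "x \<in> ?X" for x
  proof (cases "p (g x) + q (g x) = 0")
    case True
    then show ?thesis using E1(3)[OF that] zero[OF True] by (simp add: \<kappa>_def)
  next
    case False
    define a where "a = p (g x)"
    define b where "b = q (g x)"
    have ab: "a \<ge> 0" "b \<ge> 0" "a + b > 0"
      using False nonneg[of "g x"] by (auto simp: a_def b_def)
    have post: "posterior D0 D1 g (g x) = b / (a + b)" by (simp add: posterior_def a_def b_def p_def q_def)
    have E1_eq: "pmf E1 x = b * \<kappa> x" using E1(3)[OF that] by (simp add: b_def q_def)
    have one_minus: "1 - b / (a + b) = a / (a + b)" using ab by (simp add: field_simps)
    show ?thesis
    proof (cases "good (g x)")
      case True
      then have "a > 0" using good_pos False by (simp add: a_def)
      have "\<delta> \<le> a / (a + b)" using True ab by (simp add: good_def a_def b_def le_divide_eq)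
      then have \<omega>_eq: "\<omega> (b / (a + b)) = \<delta> * ((a + b) / a)" by (simp add: \<omega>_def one_minus)
      have "pmf E1 x - pmf D1 x = b * (pmf D0 x / a) - pmf D1 x"
        using True by (simp add: E1_eq \<kappa>_def a_def)
      also have "\<dots> = ((pmf D0 x + pmf D1 x) * (b / (a + b)) - pmf D1 x) * ((a + b) / a)"
      proof -
        have "((pmf D0 x + pmf D1 x) * (b / (a + b)) - pmf D1 x) * (a + b) =
            (pmf D0 x + pmf D1 x) * b - pmf D1 x * (a + b)"
          using ab by (simp add: left_diff_distrib)
        also have "\<dots> = b * pmf D0 x - pmf D1 x * a" by (simp add: algebra_simps)
        finally show ?thesis
          using \<open>a > 0\<close> by (simp only: times_divide_eq_right) (simp add: diff_divide_distrib)
      qed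
      finally show ?thesis unfolding post \<omega>_eq by simp
    next
      case False
      then have "b > 0" using bad_pos by (simp add: b_def)
      have "\<not> \<delta> \<le> a / (a + b)" using False ab by (simp add: good_def a_def b_def le_divide_eq)
      then have "\<omega> (b / (a + b)) = 0" by (simp add: \<omega>_def one_minus)
      moreover have "pmf E1 x = pmf D1 x"
        using False \<open>b > 0\<close> by (simp add: E1_eq \<kappa>_def b_def)
      ultimately show ?thesis unfolding post by simp
    qed
  qed
  have adv: "advantage A D1 E1 \<le> \<epsilon>" if "A \<in> circuits n s" for A
  proof -
    let ?S = "\<Sum>x\<in>?X. (pmf E1 x - pmf D1 x) * of_bool (circuit_eval A x)"
    have "\<delta> * ?S = calibration_error ?X \<omega> D0 D1 g (circuit_eval A)"
      unfolding calibration_error_def sum_distrib_left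
      by (intro sum.cong refl) (simp add: diff[symmetric] mult.assoc[symmetric])
    then have "\<delta> * \<bar>?S\<bar> \<le> \<delta> * \<epsilon>"
      using cal[OF that] \<delta> by (metis \<alpha>_def abs_mult abs_of_pos)
    then show ?thesis using \<delta> by (simp add: advantage_eq_sum[OF D(2) E1(1)])
  qed
  have close: "\<bar>measure_pmf.prob E0 S - measure_pmf.prob D0 S\<bar> \<le> 4 * \<delta>" for S
  proof -
    \<comment> \<open>A bad label satisfies \<open>p c < \<delta> * (p c + q c)\<close>, and the
      masses \<open>p\<close> and \<open>q\<close> each sum to 1.\<close>
    have bad: "(\<Sum>x\<in>?X. pmf E x * of_bool (\<not> good (g x))) \<le> 2 * \<delta>"
      if "set_pmf E \<subseteq> ?X" "map_pmf g E = map_pmf g D0" for E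
    proof -
      have "(\<Sum>x\<in>?X. pmf E x * of_bool (\<not> good (g x))) = (\<Sum>c<L. p c * of_bool (\<not> good c))"
        unfolding p_def that(2)[symmetric]
        by (rule sum_label[OF finite_bitstrings that(1), where v = "\<lambda>c. of_bool (\<not> good c)"]) (rule g_less)
      also have "\<dots> \<le> (\<Sum>c<L. \<delta> * (p c + q c))"
        using nonneg \<delta> by (intro sum_mono) (auto simp: good_def)
      also have "\<dots> = \<delta> * ((\<Sum>c<L. p c) + (\<Sum>c<L. q c))"
        by (simp only: sum.distrib[symmetric] sum_distrib_left)
      also have "\<dots> = \<delta> * (1 + 1)"
      proof -
        have "(\<Sum>c<L. p c) = 1" "(\<Sum>c<L. q c) = 1"
          unfolding p_def q_def using g_less by (auto intro!: sum_pmf_finite_support)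
        then show ?thesis by simp
      qed
      finally show ?thesis by simp
    qed
    have "measure_pmf.prob E0 S - measure_pmf.prob D0 S = (\<Sum>x\<in>?X. (pmf E0 x - pmf D0 x) * indicator S x)"
      by (simp only: prob_finite_support[OF finite_bitstrings E0(1)]
          prob_finite_support[OF finite_bitstrings D(1)] sum_subtractf[symmetric] left_diff_distrib)
    also have "\<bar>\<dots>\<bar> \<le> (\<Sum>x\<in>?X. pmf E0 x * of_bool (\<not> good (g x)) + pmf D0 x * of_bool (\<not> good (g x)))"
    proof (intro order.trans[OF sum_abs] sum_mono)
      fix x assume x: "x \<in> ?X"
      have "pmf E0 x = pmf D0 x" if "good (g x)"
      proof (cases "p (g x) + q (g x) = 0")
        case True
        then show ?thesis using E0(3)[OF x] zero[OF True] by (simp add: \<kappa>_def)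
      next
        case False
        then have "p (g x) > 0" using good_pos that by simp
        then show ?thesis using E0(3)[OF x] that by (simp add: \<kappa>_def p_def)
      qed
      then show "\<bar>(pmf E0 x - pmf D0 x) * indicator S x\<bar>
        \<le> pmf E0 x * of_bool (\<not> good (g x)) + pmf D0 x * of_bool (\<not> good (g x))"
        using pmf_nonneg[of E0 x] pmf_nonneg[of D0 x]
        by (cases "good (g x)") (auto simp: indicator_def simp del: pmf_nonneg)
    qed
    also have "\<dots> \<le> 2 * \<delta> + 2 * \<delta>"
      unfolding sum.distrib by (intro add_mono bad E0 D refl)
    finally show ?thesis by simp
  qed
  have inv: "1 \<le> 1 / \<epsilon> ^ 4" using \<epsilon>(1) \<epsilon>1 power_le_one[of \<epsilon> 4] by simp
  \<comment> \<open>Hence the \<open>4 / \<alpha>\<^sup>2\<close> rounds number at most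
    \<open>1024 / \<epsilon> ^ 4\<close>, and \<open>120 / \<alpha>\<^sup>2\<close> is
    \<open>30720 / \<epsilon> ^ 4\<close>.\<close>
  have \<alpha>_sq: "\<alpha>\<^sup>2 = \<epsilon> ^ 4 / 256" by (simp add: \<alpha>_def \<delta>_def power2_eq_square power4_eq_xxxx)
  have T': "real T \<le> 1024 / \<epsilon> ^ 4" using T by (simp add: \<alpha>_sq)
  have L': "real L \<le> 30721 / \<epsilon> ^ 4"
  proof -
    have "120 / \<alpha>\<^sup>2 \<ge> 0" by simp
    then have "real L \<le> 120 / \<alpha>\<^sup>2 + 1" unfolding L_def by linarith
    also have "120 / \<alpha>\<^sup>2 = 30720 * (1 / \<epsilon> ^ 4)" by (simp add: \<alpha>_sq)
    finally have "real L \<le> 30721 * (1 / \<epsilon> ^ 4)" using inv by linarith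
    then show ?thesis by simp
  qed
  let ?d = "d_circ (n * k) (nat \<lceil>1024 * real s * real k / \<epsilon> ^ 4 + (real k / \<epsilon>) powr 1024\<rceil>)
          (k_fold k D0) (k_fold k D1)"
  have TV: "d_TV (k_fold k E0) (k_fold k E1) \<le> ?d + real k * \<epsilon> / 2"
    by (rule d_TV_k_fold_le_d_circ_size[OF D E0(1) E1(1) lab \<open>L > 0\<close> E0(2) E1(2) \<kappa>_nonneg E0(3) E1(3) k \<epsilon> T' _ L'])
      auto
  have "d_TV (k_fold k D0) (k_fold k E1) \<le> ?d + real k * \<epsilon>"
  proof (rule d_TV_leI)
    fix S
    have "\<bar>measure_pmf.prob (k_fold k E0) S - measure_pmf.prob (k_fold k D0) S\<bar> \<le> real k * (4 * \<delta>)"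
      unfolding prob_k_fold by (rule prob_replicate_pmf_hybrid[OF finite_bitstrings E0(1) D(1) close])
    moreover have "real k * (4 * \<delta>) \<le> real k * \<epsilon> / 2" using \<epsilon> by (simp add: \<delta>_def)
    ultimately show "measure_pmf.prob (k_fold k E1) S - measure_pmf.prob (k_fold k D0) S \<le> ?d + real k * \<epsilon>"
      using TV d_TV_upper[of "k_fold k E0" S "k_fold k E1"] by linarith
  qed
  then show ?thesis by (intro that[of E1] E1 d_circ_leI adv)
qed

text \<open>
  If \<open>k / \<epsilon>\<close> is close to \<open>1\<close>, no absolute constant \<open>C\<close> makes \<open>(k / \<epsilon>) powr C\<close> large, so this range
  needs a pair that works for every circuit size.
\<close>

lemma indistinguishable_single_exists_trivial:
  fixes \<epsilon> :: real
  assumes D: "set_pmf D0 \<subseteq> bitstrings n" "set_pmf D1 \<subseteq> bitstrings n" and "\<epsilon> > 0"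
    and small: "k = 0 \<or> real k * \<epsilon> > 1 \<or> real k / \<epsilon> < 2"
  obtains E1 where "set_pmf E1 \<subseteq> bitstrings n" "d_circ n s D1 E1 \<le> \<epsilon>"
    "\<And>t. d_TV (k_fold k D0) (k_fold k E1) \<le> d_circ (n * k) t (k_fold k D0) (k_fold k D1) + real k * \<epsilon>"
proof (cases "k = 0 \<or> real k * \<epsilon> > 1")
  case True
  \<comment> \<open>\<open>D1\<close> can be kept: for \<open>k = 0\<close> both products are the
    same point mass, and for \<open>k * \<epsilon> > 1\<close> the bound exceeds every total
    variation distance.\<close>
  have "d_TV (k_fold k D0) (k_fold k D1) \<le> real k * \<epsilon>"
  proof (cases "k = 0")
    case False
    then show ?thesis using True d_TV_le_1[of "k_fold k D0" "k_fold k D1"] by linarith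
  qed (auto simp: k_fold_def intro!: d_TV_leI)
  moreover have "d_circ n s D1 D1 \<le> \<epsilon>"
    using \<open>\<epsilon> > 0\<close> by (intro d_circ_leI) (simp add: advantage_def)
  ultimately show ?thesis
    using that[of D1] D d_circ_nonneg[of "n * k" _ "k_fold k D0" "k_fold k D1"]
    by (metis add_increasing)
next
  case False
  then have k: "real k \<ge> 1" "real k * \<epsilon> \<le> 1" by auto
  \<comment> \<open>Together with \<open>k * \<epsilon> \<le> 1\<close> this gives
    \<open>k * k < 2\<close>, so only \<open>k = 1\<close> with \<epsilon> between 1/2 and 1
    remains.\<close>
  have "real k < 2 * \<epsilon>" using small False \<open>\<epsilon> > 0\<close> by (simp add: divide_less_eq)
  then have "real k * real k < 2 * \<epsilon> * real k" using k(1) by (intro mult_strict_right_mono) auto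
  also have "\<dots> \<le> 2" using k(2) by (simp add: mult.commute)
  finally have "k * k < 2" by (metis of_nat_less_iff of_nat_mult of_nat_numeral)
  then have "k < 2" using mult_le_mono[of 2 k 2 k] by (cases "k < 2") auto
  then have k1: "k = 1" using False by auto
  have \<epsilon>: "1/2 \<le> \<epsilon>" "\<epsilon> \<le> 1" using \<open>real k < 2 * \<epsilon>\<close> k by (auto simp: k1)
  \<comment> \<open>In total variation this is within \<epsilon> of \<open>D1\<close> and within
    \<open>1 - \<epsilon> \<le> \<epsilon>\<close> of \<open>D0\<close>.\<close>
  define E1 where "E1 = mix \<epsilon> D1 D0"
  have fin: "finite (set_pmf D1)" "finite (set_pmf D0)"
    using D finite_bitstrings finite_subset by blast+
  have E1: "set_pmf E1 \<subseteq> bitstrings n" using set_mix[of \<epsilon> D1 D0] D by (auto simp: E1_def)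
  have fold: "k_fold k P = P" for P
    unfolding k1 k_fold_def replicate_pmf_1 map_pmf_comp by simp
  have "d_circ n s D1 E1 \<le> \<epsilon>"
  proof (rule d_circ_leI)
    fix A
    have "advantage A D1 E1 \<le> \<epsilon> * d_TV D1 D0"
      unfolding advantage_eq_prob E1_def using \<epsilon> fin by (intro prob_mix_diff) auto
    also have "\<dots> \<le> \<epsilon>" using \<epsilon> by (intro mult_left_le d_TV_le_1) auto
    finally show "advantage A D1 E1 \<le> \<epsilon>" .
  qed
  moreover have "d_TV D0 E1 \<le> \<epsilon>"
  proof (rule d_TV_leI)
    fix S
    have "measure_pmf.prob E1 S - measure_pmf.prob D0 S =
        (1 - \<epsilon>) * (measure_pmf.prob D1 S - measure_pmf.prob D0 S)"
      unfolding E1_def using \<epsilon> fin by (subst prob_mix) (auto simp: algebra_simps)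
    also have "\<dots> \<le> (1 - \<epsilon>) * 1"
      using \<epsilon> measure_pmf.prob_le_1[of D1 S] measure_nonneg[of "measure_pmf D0" S]
      by (intro mult_left_mono) linarith+
    also have "\<dots> \<le> \<epsilon>" using \<epsilon> by simp
    finally show "measure_pmf.prob E1 S - measure_pmf.prob D0 S \<le> \<epsilon>" .
  qed
  moreover have "0 \<le> d_circ (n * k) t D0 D1" for t by (rule d_circ_nonneg)
  ultimately show ?thesis
    using that[of E1] E1 unfolding fold by (simp add: k1 add_increasing)
qed

theorem theorem1p4:
  shows "\<exists>C::real. C > 0 \<and>
    (\<forall>(n::nat) (s::nat) (k::nat) (\<epsilon>::real) (D0::bool list pmf) (D1::bool list pmf).
      \<epsilon> > 0 \<and> set_pmf D0 \<subseteq> bitstrings n \<and> set_pmf D1 \<subseteq> bitstrings n \<longrightarrow>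
      (\<exists>E0 E1 :: bool list pmf.
         set_pmf E0 \<subseteq> bitstrings n \<and> set_pmf E1 \<subseteq> bitstrings n \<and>
         d_circ n s D0 E0 \<le> \<epsilon> \<and> d_circ n s D1 E1 \<le> \<epsilon> \<and>
         d_circ (n * k) s (k_fold k D0) (k_fold k D1) - real k * \<epsilon>
           \<le> d_TV (k_fold k E0) (k_fold k E1) \<and>
         d_TV (k_fold k E0) (k_fold k E1)
           \<le> d_circ (n * k) (nat \<lceil>C * real s * real k / \<epsilon> ^ 2 + (real k / \<epsilon>) powr C\<rceil>)
                (k_fold k D0) (k_fold k D1) + real k * \<epsilon>) \<and>
      (\<exists>E0 E1 :: bool list pmf.
         set_pmf E0 \<subseteq> bitstrings n \<and> set_pmf E1 \<subseteq> bitstrings n \<and>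
         E0 = D0 \<and>
         d_circ n s D0 E0 \<le> \<epsilon> \<and> d_circ n s D1 E1 \<le> \<epsilon> \<and>
         d_circ (n * k) s (k_fold k D0) (k_fold k D1) - real k * \<epsilon>
           \<le> d_TV (k_fold k E0) (k_fold k E1) \<and>
         d_TV (k_fold k E0) (k_fold k E1)
           \<le> d_circ (n * k) (nat \<lceil>C * real s * real k / \<epsilon> ^ 4 + (real k / \<epsilon>) powr C\<rceil>)
                (k_fold k D0) (k_fold k D1) + real k * \<epsilon>))"
proof (rule exI[of _ 1024], intro conjI allI impI; (elim conjE)?)
  \<comment> \<open>The witness 1024 is the factor in the round bound of the second construction; as
    an exponent it exceeds the 56 reached in \<open>size_bound\<close>.\<close>
  fix n s k :: nat and \<epsilon> :: real and D0 D1 :: "bool list pmf"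
  assume \<epsilon>: "\<epsilon> > 0" and D: "set_pmf D0 \<subseteq> bitstrings n" "set_pmf D1 \<subseteq> bitstrings n"
  \<comment> \<open>Keeping \<open>D0\<close> costs nothing, which leaves all of \<epsilon> for
    \<open>D1\<close> in the lower bound.\<close>
  have refl: "d_circ n s D0 D0 \<le> 0" by (intro d_circ_leI) (simp add: advantage_def)
  show "\<exists>E0 E1. set_pmf E0 \<subseteq> bitstrings n \<and> set_pmf E1 \<subseteq> bitstrings n \<and>
         d_circ n s D0 E0 \<le> \<epsilon> \<and> d_circ n s D1 E1 \<le> \<epsilon> \<and>
         d_circ (n * k) s (k_fold k D0) (k_fold k D1) - real k * \<epsilon>
           \<le> d_TV (k_fold k E0) (k_fold k E1) \<and>
         d_TV (k_fold k E0) (k_fold k E1)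
           \<le> d_circ (n * k) (nat \<lceil>1024 * real s * real k / \<epsilon> ^ 2 + (real k / \<epsilon>) powr 1024\<rceil>)
                (k_fold k D0) (k_fold k D1) + real k * \<epsilon>"
  proof (cases "k = 0 \<or> real k * \<epsilon> > 1 \<or> real k / \<epsilon> < 2")
    case True
    \<comment> \<open>In this range a pair with \<open>E0 = D0\<close> serves the first claim as
      well.\<close>
    obtain E1 where E1: "set_pmf E1 \<subseteq> bitstrings n" "d_circ n s D1 E1 \<le> \<epsilon>"
      "\<And>t. d_TV (k_fold k D0) (k_fold k E1) \<le> d_circ (n * k) t (k_fold k D0) (k_fold k D1) + real k * \<epsilon>"
      using indistinguishable_single_exists_trivial[OF D \<epsilon> True] by metis
    show ?thesis
      using E1 refl \<epsilon> D d_circ_k_fold_le_d_TV[OF D D(1) E1(1) refl E1(2)]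
      by - (rule exI[of _ D0], rule exI[of _ E1], auto)
  next
    case False
    then have k: "k \<ge> 1" "real k * \<epsilon> \<le> 1" "real k / \<epsilon> \<ge> 2" by auto
    obtain E0 E1 where E: "set_pmf E0 \<subseteq> bitstrings n" "set_pmf E1 \<subseteq> bitstrings n"
      "d_circ n s D0 E0 \<le> \<epsilon> / 2" "d_circ n s D1 E1 \<le> \<epsilon> / 2"
      "d_TV (k_fold k E0) (k_fold k E1)
        \<le> d_circ (n * k) (nat \<lceil>1024 * real s * real k / \<epsilon> ^ 2 + (real k / \<epsilon>) powr 1024\<rceil>)
            (k_fold k D0) (k_fold k D1) + real k * \<epsilon> / 2"
      by (rule indistinguishable_pair_exists[OF D k(1) \<epsilon> k(2,3)])
    have "0 \<le> real k * \<epsilon>" using \<epsilon> by simp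
    with E(5) have "d_TV (k_fold k E0) (k_fold k E1)
        \<le> d_circ (n * k) (nat \<lceil>1024 * real s * real k / \<epsilon> ^ 2 + (real k / \<epsilon>) powr 1024\<rceil>)
            (k_fold k D0) (k_fold k D1) + real k * \<epsilon>"
      by linarith
    then show ?thesis
      using E \<epsilon> d_circ_k_fold_le_d_TV[OF D E(1-4), of k]
      by - (rule exI[of _ E0], rule exI[of _ E1], auto)
  qed
  show "\<exists>E0 E1. set_pmf E0 \<subseteq> bitstrings n \<and> set_pmf E1 \<subseteq> bitstrings n \<and> E0 = D0 \<and>
         d_circ n s D0 E0 \<le> \<epsilon> \<and> d_circ n s D1 E1 \<le> \<epsilon> \<and>
         d_circ (n * k) s (k_fold k D0) (k_fold k D1) - real k * \<epsilon>
           \<le> d_TV (k_fold k E0) (k_fold k E1) \<and>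
         d_TV (k_fold k E0) (k_fold k E1)
           \<le> d_circ (n * k) (nat \<lceil>1024 * real s * real k / \<epsilon> ^ 4 + (real k / \<epsilon>) powr 1024\<rceil>)
                (k_fold k D0) (k_fold k D1) + real k * \<epsilon>"
  proof -
    obtain E1 where E1: "set_pmf E1 \<subseteq> bitstrings n" "d_circ n s D1 E1 \<le> \<epsilon>"
      "d_TV (k_fold k D0) (k_fold k E1)
        \<le> d_circ (n * k) (nat \<lceil>1024 * real s * real k / \<epsilon> ^ 4 + (real k / \<epsilon>) powr 1024\<rceil>)
            (k_fold k D0) (k_fold k D1) + real k * \<epsilon>"
    proof (cases "k = 0 \<or> real k * \<epsilon> > 1 \<or> real k / \<epsilon> < 2")
      case True
      show ?thesis using indistinguishable_single_exists_trivial[OF D \<epsilon> True] that by metis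
    next
      case False
      then have "k \<ge> 1" "real k * \<epsilon> \<le> 1" "real k / \<epsilon> \<ge> 2" by auto
      from indistinguishable_single_exists[OF D this(1) \<epsilon> this(2,3)] that show ?thesis by metis
    qed
    show ?thesis
      using E1 refl \<epsilon> D d_circ_k_fold_le_d_TV[OF D D(1) E1(1) refl E1(2)]
      by - (rule exI[of _ D0], rule exI[of _ E1], auto)
  qed
qed simp

end
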